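(* Let $\mathfrak A$ be a unital JB-algebra and suppose a weighted 2-mean $H_2$ in $\mathfrak A$ is a Lie-Trotter mean (i.e. $H_2(1-\lambda,\lambda;\cdot)$, $\lambda\in(0,1)$, is a two-variable Lie-Trotter mean). Then for every $n\ge2$ the associated Hansen's inductive mean $H_n$ is a multivariate Lie-Trotter mean.
   Context: A (real) Jordan algebra is a real vector space $\mathfrak A$ with a bilinear product $\circ$ satisfying $A\circ B=B\circ A$ and $(A^2\circ B)\circ A=A^2\circ(B\circ A)$, where $A^2=A\circ A$. A JB-algebra is a Jordan algebra over $\mathbb R$ with a complete norm such that $\|A\circ B\|\le\|A\|\|B\|$, $\|A^2\|=\|A\|^2$ and $\|A^2\|\le\|A^2+B^2\|$. In a unital JB-algebra with unit $I$, $A$ is invertible with (Jordan) inverse $B=A^{-1}$ if $A\circ B=I$ and $A^2\circ B=A$; the spectrum of $A$ is $\{\lambda\in\mathbb R: A-\lambda I \text{ is not invertible}\}$; $A$ is positive if its spectrum lies in $[0,\infty)$. $\mathfrak A_{++}$ is the open convex cone of positive invertible elements. Real powers, $\exp$ and $\log$ are given by functional calculus in $\mathfrak A$. $\Delta_n$ denotes the set of probability vectors $\omega=(\omega_1,\dots,\omega_n)$ in $\mathbb R^n$ with all $\omega_k>0$. A weighted 2-mean is, for weights $\lambda\in(0,1)$, a map $G_2(1-\lambda,\lambda;\cdot):\mathfrak A_{++}^2\to\mathfrak A_{++}$ with $G_2(1-\lambda,\lambda;A,A)=A$ for all $A\in\mathfrak A_{++}$. It is a two-variable Lie-Trotter mean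 if it is differentiable and $\lim_{t\to0}G_2(1-\lambda,\lambda;\gamma_1(t),\gamma_2(t))^{1/t}=\exp[(1-\lambda)\gamma_1'(0)+\lambda\gamma_2'(0)]$ for all differentiable curves $\gamma_1,\gamma_2:(-\varepsilon,\varepsilon)\to\mathfrak A_{++}$ with $\gamma_1(0)=\gamma_2(0)=I$. Here $H_2$ is given for all weights $\lambda\in(0,1)$ and has these properties for each of them. A weighted $n$-mean ($n\ge2$, $\omega\in\Delta_n$) is a map $G_n(\omega;\cdot):\mathfrak A_{++}^n\to\mathfrak A_{++}$ with $G_n(\omega;A,\dots,A)=A$ for all $A\in\mathfrak A_{++}$. It is a multivariate Lie-Trotter mean if $\lim_{t\to0}G_n(\omega;\gamma_1(t),\dots,\gamma_n(t))^{1/t}=\exp\left(\sum_{k=1}^n\omega_k\gamma_k'(0)\right)$ for all differentiable curves $\gamma_k:(-\varepsilon,\varepsilon)\to\mathfrak A_{++}$ with $\gamma_k(0)=I$, $1\le k\le n$. Hansen's inductive mean associated with $H_2$: for $n\ge3$, $\omega\in\Delta_n$ and $A_1,\dots,A_n\in\mathfrak A_{++}$, inductively $$H_n(\omega;A_1,\dots,A_n)=H_{n-1}\left(\hat\omega;\,H_2(1-\omega_n,\omega_n;A_1,A_n),\dots,H_2(1-\omega_n,\omega_n;A_{n-1},A_n)\right),$$ where $\hat\omega=\tfrac1{1-\omega_n}(\omega_1,\dots,\omega_{n-1})\in\Delta_{n-1}$. *)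

theory Defs
  imports "HOL-Analysis.Analysis" "HOL-Computational_Algebra.Polynomial"
begin

section \<open>Unital JB-algebras\<close>

class jordan_algebra = real_vector +
  fixes jprod :: "'a \<Rightarrow> 'a \<Rightarrow> 'a"  (infixl "\<circ>\<^sub>J" 70)
  assumes jprod_commute: "A \<circ>\<^sub>J B = B \<circ>\<^sub>J A"
    and jprod_add_left: "(A + B) \<circ>\<^sub>J C = A \<circ>\<^sub>J C + B \<circ>\<^sub>J C"
    and jprod_scaleR_left: "(r *\<^sub>R A) \<circ>\<^sub>J B = r *\<^sub>R (A \<circ>\<^sub>J B)"
    and jordan_identity: "((A \<circ>\<^sub>J A) \<circ>\<^sub>J B) \<circ>\<^sub>J A = (A \<circ>\<^sub>J A) \<circ>\<^sub>J (B \<circ>\<^sub>J A)"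

class jb_algebra = jordan_algebra + banach +
  assumes norm_jprod_le: "norm (A \<circ>\<^sub>J B) \<le> norm A * norm B"
    and norm_jsquare: "norm (A \<circ>\<^sub>J A) = (norm A)\<^sup>2"
    and norm_jsquare_le_add: "norm (A \<circ>\<^sub>J A) \<le> norm (A \<circ>\<^sub>J A + B \<circ>\<^sub>J B)"

class unital_jb_algebra = jb_algebra + one +
  assumes jprod_one_left: "1 \<circ>\<^sub>J A = A"


section \<open>Spectrum, positivity and functional calculus\<close>

definition jinvertible :: "'a::unital_jb_algebra \<Rightarrow> bool" where
  "jinvertible A \<longleftrightarrow> (\<exists>B. A \<circ>\<^sub>J B = 1 \<and> (A \<circ>\<^sub>J A) \<circ>\<^sub>J B = A)"

definition jspectrum :: "'a::unital_jb_algebra \<Rightarrow> real set" where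
  "jspectrum A = {r. \<not> jinvertible (A - r *\<^sub>R 1)}"

definition jpositive :: "'a::unital_jb_algebra \<Rightarrow> bool" where
  "jpositive A \<longleftrightarrow> jspectrum A \<subseteq> {0..}"

definition pos_cone :: "'a::unital_jb_algebra set" where
  "pos_cone = {A. jpositive A \<and> jinvertible A}"

primrec jpower :: "'a::unital_jb_algebra \<Rightarrow> nat \<Rightarrow> 'a" where
  "jpower A 0 = 1"
| "jpower A (Suc n) = A \<circ>\<^sub>J jpower A n"

definition jpoly :: "real poly \<Rightarrow> 'a::unital_jb_algebra \<Rightarrow> 'a" where
  "jpoly p A = (\<Sum>i\<le>degree p. coeff p i *\<^sub>R jpower A i)"

text \<open>Continuous functional calculus: \<open>f(A)\<close> is the limit of \<open>p\<^sub>n(A)\<close> for polynomials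
  \<open>p\<^sub>n\<close> converging to \<open>f\<close> uniformly on the spectrum of \<open>A\<close>.  Since
  the norm of \<open>p(A)\<close> is the supremum of \<open>\<bar>p\<bar>\<close> on the spectrum, the limit exists and does not
  depend on the sequence when \<open>f\<close> is continuous on the spectrum, and it is the image of \<open>f\<close>
  under the isomorphism from the continuous functions on the spectrum onto the closed
  subalgebra generated by \<open>A\<close> and the unit.\<close>

definition jfun_calc :: "(real \<Rightarrow> real) \<Rightarrow> 'a::unital_jb_algebra \<Rightarrow> 'a" where
  "jfun_calc f A = (THE B. \<exists>p :: nat \<Rightarrow> real poly.
     uniform_limit (jspectrum A) (\<lambda>n. poly (p n)) f sequentially \<and>
     (\<lambda>n. jpoly (p n) A) \<longlonglongrightarrow> B)"

definition jexp :: "'a::unital_jb_algebra \<Rightarrow> 'a" where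
  "jexp A = jfun_calc exp A"

definition jpowr :: "'a::unital_jb_algebra \<Rightarrow> real \<Rightarrow> 'a"  (infixr "powr\<^sub>J" 80) where
  "A powr\<^sub>J r = jfun_calc (\<lambda>x. x powr r) A"


section \<open>Lie-Trotter means\<close>

text \<open>Curves are total functions on the reals, constrained only on the interval
  \<open>(-\<epsilon>, \<epsilon>)\<close>.\<close>

definition curve_at_unit :: "real \<Rightarrow> (real \<Rightarrow> 'a::unital_jb_algebra) \<Rightarrow> bool" where
  "curve_at_unit \<epsilon> \<gamma> \<longleftrightarrow>
     \<gamma> ` {-\<epsilon><..<\<epsilon>} \<subseteq> pos_cone \<and> \<gamma> differentiable_on {-\<epsilon><..<\<epsilon>} \<and> \<gamma> 0 = 1"

definition weighted_2mean :: "('a::unital_jb_algebra \<Rightarrow> 'a \<Rightarrow> 'a) \<Rightarrow> bool" where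
  "weighted_2mean G \<longleftrightarrow>
     (\<forall>A\<in>pos_cone. \<forall>B\<in>pos_cone. G A B \<in> pos_cone) \<and> (\<forall>A\<in>pos_cone. G A A = A)"

text \<open>\<open>G\<close> stands for \<open>G\<^sub>2(1 - \<lambda>, \<lambda>; \<cdot>)\<close>; differentiability is Frechet differentiability
  jointly in both variables.\<close>

definition lie_trotter_2mean :: "real \<Rightarrow> ('a::unital_jb_algebra \<Rightarrow> 'a \<Rightarrow> 'a) \<Rightarrow> bool" where
  "lie_trotter_2mean l G \<longleftrightarrow>
     weighted_2mean G \<and>
     (\<lambda>(A, B). G A B) differentiable_on (pos_cone \<times> pos_cone) \<and>
     (\<forall>\<epsilon>>0. \<forall>\<gamma>1 \<gamma>2. curve_at_unit \<epsilon> \<gamma>1 \<and> curve_at_unit \<epsilon> \<gamma>2 \<longrightarrow>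
        ((\<lambda>t. G (\<gamma>1 t) (\<gamma>2 t) powr\<^sub>J (1 / t)) \<longlongrightarrow>
           jexp ((1 - l) *\<^sub>R vector_derivative \<gamma>1 (at 0) + l *\<^sub>R vector_derivative \<gamma>2 (at 0)))
        (at 0))"

text \<open>Vectors and \<open>n\<close>-tuples are lists of length \<open>n\<close>, so the weight \<open>\<omega>\<^sub>k\<close> is
  \<open>\<omega> ! (k - 1)\<close>.\<close>

definition prob_vectors :: "nat \<Rightarrow> real list set" where
  "prob_vectors n = {\<omega>. length \<omega> = n \<and> (\<forall>x\<in>set \<omega>. x > 0) \<and> sum_list \<omega> = 1}"

definition weighted_mean :: "nat \<Rightarrow> ('a::unital_jb_algebra list \<Rightarrow> 'a) \<Rightarrow> bool" where
  "weighted_mean n G \<longleftrightarrow>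
     (\<forall>As. length As = n \<and> set As \<subseteq> pos_cone \<longrightarrow> G As \<in> pos_cone) \<and>
     (\<forall>A\<in>pos_cone. G (replicate n A) = A)"

definition lie_trotter_mean ::
    "nat \<Rightarrow> real list \<Rightarrow> ('a::unital_jb_algebra list \<Rightarrow> 'a) \<Rightarrow> bool" where
  "lie_trotter_mean n \<omega> G \<longleftrightarrow>
     weighted_mean n G \<and>
     (\<forall>\<epsilon>>0. \<forall>\<gamma>s. length \<gamma>s = n \<and> (\<forall>\<gamma>\<in>set \<gamma>s. curve_at_unit \<epsilon> \<gamma>) \<longrightarrow>
        ((\<lambda>t. G (map (\<lambda>\<gamma>. \<gamma> t) \<gamma>s) powr\<^sub>J (1 / t)) \<longlongrightarrow>
           jexp (\<Sum>k<n. (\<omega> ! k) *\<^sub>R vector_derivative (\<gamma>s ! k) (at 0)))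
        (at 0))"

text \<open>For \<open>n < 2\<close> the value is irrelevant.\<close>

fun hansen_mean ::
    "(real \<Rightarrow> real \<Rightarrow> 'a::unital_jb_algebra \<Rightarrow> 'a \<Rightarrow> 'a) \<Rightarrow> nat \<Rightarrow> real list \<Rightarrow> 'a list \<Rightarrow> 'a" where
  "hansen_mean H2 n \<omega> As =
     (if n \<le> 2 then H2 (\<omega> ! 0) (\<omega> ! 1) (As ! 0) (As ! 1)
      else hansen_mean H2 (n - 1)
             (map (\<lambda>x. x / (1 - last \<omega>)) (butlast \<omega>))
             (map (\<lambda>A. H2 (1 - last \<omega>) (last \<omega>) A (last As)) (butlast As)))"

declare hansen_mean.simps [simp del]

end

theory Submission
  imports Defs "HOL-Computational_Algebra.Fundamental_Theorem_Algebra"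
begin

text \<open>
For a curve \<open>\<gamma>\<close> with \<open>\<gamma> 0 = 1\<close> that is differentiable at \<open>0\<close>, the powers \<open>\<gamma> t powr\<^sub>J (1 / t)\<close> converge to
\<open>jexp (\<gamma>' 0)\<close> (\<open>tendsto_jpowr_inverse_at_unit\<close>), and \<open>jexp\<close> is injective (\<open>inj_jexp\<close>).
Hence the Lie-Trotter property of a two-variable mean amounts to a rule for derivatives: the mean
of two curves through the unit is again such a curve, and its derivative at \<open>0\<close> is the weighted
arithmetic mean of their derivatives (\<open>lie_trotter_2mean_curve\<close>).  One step of Hansen's recursion therefore turns \<open>n + 1\<close>
curves into \<open>n\<close> curves with known derivatives, and induction on \<open>n\<close> gives the theorem
(\<open>hansen_mean_lie_trotter\<close>).

The two facts about \<open>powr\<^sub>J\<close> and \<open>jexp\<close> rest on the functional calculus, and this rests on one estimate: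
the norm of \<open>p(A)\<close> is at most the supremum of \<open>\<bar>p\<bar>\<close> on the spectrum of \<open>A\<close>
(\<open>norm_jpoly_attained\<close>, \<open>norm_jpoly_le\<close>).  It is proved without complexification.  Jordan algebras are power
associative, so \<open>p \<mapsto> p(A)\<close> is a ring homomorphism on real polynomials, and \<open>p \<mapsto> \<parallel>p(A)\<parallel>\<close> is a
seminorm that satisfies the JB axioms on squares.  If \<open>\<parallel>d(A)\<parallel> = 1\<close>, suitable powers of \<open>d\<^sup>2\<close> are
approximate eigenvectors of \<open>d(A)\<^sup>2\<close> for the eigenvalue \<open>1\<close> (\<open>norm_jpoly_approx_eigen\<close>).  If on the other hand
\<open>1 - d\<^sup>2\<close> has no root in the spectrum of \<open>A\<close>, then multiplication by \<open>(1 - d\<^sup>2)(A)\<close> is bounded below on polynomials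
in \<open>A\<close>: linear factors are so because of Jordan inverses, and quadratic factors without real roots because of the
axiom on sums of two squares.  The two conclusions contradict each other.
\<close>

section \<open>Power associativity\<close>

lemma jprod_add_right: "A \<circ>\<^sub>J (B + C) = A \<circ>\<^sub>J B + A \<circ>\<^sub>J (C::'a::jordan_algebra)"
  by (metis jprod_add_left jprod_commute)

lemma jprod_scaleR_right: "A \<circ>\<^sub>J (r *\<^sub>R B) = r *\<^sub>R (A \<circ>\<^sub>J (B::'a::jordan_algebra))"
  by (metis jprod_scaleR_left jprod_commute)

lemma bounded_bilinear_jprod: "bounded_bilinear (jprod :: 'a::jb_algebra \<Rightarrow> 'a \<Rightarrow> 'a)"
proof
  show "\<exists>K. \<forall>a b::'a. norm (a \<circ>\<^sub>J b) \<le> norm a * norm b * K"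
    by (rule exI[of _ 1]) (simp add: norm_jprod_le)
qed (auto simp: jprod_add_left jprod_add_right jprod_scaleR_left jprod_scaleR_right)

interpretation jprod: bounded_bilinear "jprod :: 'a::jb_algebra \<Rightarrow> 'a \<Rightarrow> 'a"
  by (rule bounded_bilinear_jprod)

text \<open>
The Jordan identity says that a cubic form in \<open>a\<close> vanishes, so its symmetric trilinear
polarization vanishes too.
\<close>

lemma jordan_identity_linearized:
  fixes a b c d :: "'a::jordan_algebra"
  shows "((a \<circ>\<^sub>J c) \<circ>\<^sub>J b) \<circ>\<^sub>J d + ((c \<circ>\<^sub>J d) \<circ>\<^sub>J b) \<circ>\<^sub>J a + ((d \<circ>\<^sub>J a) \<circ>\<^sub>J b) \<circ>\<^sub>J c =
    (a \<circ>\<^sub>J c) \<circ>\<^sub>J (b \<circ>\<^sub>J d) + (c \<circ>\<^sub>J d) \<circ>\<^sub>J (b \<circ>\<^sub>J a) + (d \<circ>\<^sub>J a) \<circ>\<^sub>J (b \<circ>\<^sub>J c)"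
proof -
  define g where "g x y z = ((x \<circ>\<^sub>J y) \<circ>\<^sub>J b) \<circ>\<^sub>J z - (x \<circ>\<^sub>J y) \<circ>\<^sub>J (b \<circ>\<^sub>J z)" for x y z :: 'a
  have add: "g (x + x') y z = g x y z + g x' y z" "g x (y + x') z = g x y z + g x x' z"
    "g x y (z + x') = g x y z + g x y x'" for x x' y z
    by (simp_all add: g_def jprod_add_left jprod_add_right)
  have sym: "g x y z = g y x z" for x y z
    by (simp add: g_def jprod_commute)
  define h where "h x = g x x x" for x
  have h: "h x = 0" for x
    by (simp add: h_def g_def jordan_identity)
  have "2 *\<^sub>R (g a c d + g c d a + g d a c) =
      h (a + c + d) - h (a + c) - h (a + d) - h (c + d) + h a + h c + h d"
    unfolding h_def add sym[of c a] sym[of d a] sym[of d c]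
    by (simp add: algebra_simps scaleR_2)
  then have "g a c d + g c d a + g d a c = 0"
    by (simp add: h)
  then show ?thesis by (simp add: g_def algebra_simps)
qed

text \<open>
The linearized identity is read here with \<open>x\<close> as one of the three symmetric arguments.
It expresses multiplication by a product \<open>(a \<circ>\<^sub>J c) \<circ>\<^sub>J b\<close> through multiplications
by shorter products, which is what makes an induction over powers possible.
\<close>

lemma jprod_operator_identity:
  fixes a b c x :: "'a::jordan_algebra"
  shows "((a \<circ>\<^sub>J c) \<circ>\<^sub>J b) \<circ>\<^sub>J x =
    (a \<circ>\<^sub>J c) \<circ>\<^sub>J (b \<circ>\<^sub>J x) + (a \<circ>\<^sub>J b) \<circ>\<^sub>J (c \<circ>\<^sub>J x) + (b \<circ>\<^sub>J c) \<circ>\<^sub>J (a \<circ>\<^sub>J x)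
      - a \<circ>\<^sub>J (b \<circ>\<^sub>J (c \<circ>\<^sub>J x)) - c \<circ>\<^sub>J (b \<circ>\<^sub>J (a \<circ>\<^sub>J x))"
proof -
  have "((a \<circ>\<^sub>J c) \<circ>\<^sub>J b) \<circ>\<^sub>J x + a \<circ>\<^sub>J (b \<circ>\<^sub>J (c \<circ>\<^sub>J x)) + c \<circ>\<^sub>J (b \<circ>\<^sub>J (a \<circ>\<^sub>J x)) =
    (a \<circ>\<^sub>J c) \<circ>\<^sub>J (b \<circ>\<^sub>J x) + (a \<circ>\<^sub>J b) \<circ>\<^sub>J (c \<circ>\<^sub>J x) + (b \<circ>\<^sub>J c) \<circ>\<^sub>J (a \<circ>\<^sub>J x)"
    using jordan_identity_linearized[of a c b x]
    by (metis (no_types) jprod_commute add.assoc add.commute)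
  then show ?thesis by (simp add: algebra_simps)
qed

lemma jpower_Suc_Suc_operator:
  fixes a x :: "'a::unital_jb_algebra"
  shows "jpower a (Suc (Suc n)) \<circ>\<^sub>J x =
    2 *\<^sub>R (jpower a (Suc n) \<circ>\<^sub>J (a \<circ>\<^sub>J x)) + (a \<circ>\<^sub>J a) \<circ>\<^sub>J (jpower a n \<circ>\<^sub>J x)
      - a \<circ>\<^sub>J (a \<circ>\<^sub>J (jpower a n \<circ>\<^sub>J x)) - jpower a n \<circ>\<^sub>J (a \<circ>\<^sub>J (a \<circ>\<^sub>J x))"
  using jprod_operator_identity[of a "jpower a n" a x] jprod_commute[of "jpower a n" a]
    jprod_commute[of "a \<circ>\<^sub>J jpower a n" a]
  by (simp add: scaleR_2)

lemma jsquare_operator_commute: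
  fixes a x :: "'a::jordan_algebra"
  shows "a \<circ>\<^sub>J ((a \<circ>\<^sub>J a) \<circ>\<^sub>J x) = (a \<circ>\<^sub>J a) \<circ>\<^sub>J (a \<circ>\<^sub>J x)"
  by (metis jordan_identity jprod_commute)

text \<open>
By the recursion for the multiplication operators, multiplication by a power of \<open>a\<close> is a
polynomial in the multiplications by \<open>a\<close> and by \<open>a \<circ>\<^sub>J a\<close>; these two commute by
the Jordan identity.  Commutation with multiplication by \<open>a\<close> is power associativity.
\<close>

lemma jpower_operator_commute:
  fixes a x :: "'a::unital_jb_algebra"
  shows "jpower a n \<circ>\<^sub>J (a \<circ>\<^sub>J x) = a \<circ>\<^sub>J (jpower a n \<circ>\<^sub>J x)
    \<and> jpower a n \<circ>\<^sub>J ((a \<circ>\<^sub>J a) \<circ>\<^sub>J x) = (a \<circ>\<^sub>J a) \<circ>\<^sub>J (jpower a n \<circ>\<^sub>J x)"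
proof (induction n arbitrary: x rule: less_induct)
  case (less n)
  consider "n = 0" | "n = 1" | m where "n = Suc (Suc m)"
    by (metis One_nat_def not0_implies_Suc)
  then show ?case
  proof cases
    case 1
    then show ?thesis by (simp add: jprod_one_left)
  next
    case 2
    then show ?thesis
      by (simp add: jprod_one_left jprod_commute[of a 1] jsquare_operator_commute)
  next
    case 3
    have *: "jpower a m \<circ>\<^sub>J (a \<circ>\<^sub>J y) = a \<circ>\<^sub>J (jpower a m \<circ>\<^sub>J y)"
       "jpower a m \<circ>\<^sub>J ((a \<circ>\<^sub>J a) \<circ>\<^sub>J y) = (a \<circ>\<^sub>J a) \<circ>\<^sub>J (jpower a m \<circ>\<^sub>J y)"
       "jpower a (Suc m) \<circ>\<^sub>J (a \<circ>\<^sub>J y) = a \<circ>\<^sub>J (jpower a (Suc m) \<circ>\<^sub>J y)"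
       "jpower a (Suc m) \<circ>\<^sub>J ((a \<circ>\<^sub>J a) \<circ>\<^sub>J y) = (a \<circ>\<^sub>J a) \<circ>\<^sub>J (jpower a (Suc m) \<circ>\<^sub>J y)" for y
      using less.IH[of m y] less.IH[of "Suc m" y] 3 by auto
    show ?thesis
      unfolding 3 jpower_Suc_Suc_operator
      by (simp add: * jprod_add_right jprod_scaleR_right jprod.diff_right jsquare_operator_commute
          del: jpower.simps)
  qed
qed

lemma jpower_add:
  fixes a :: "'a::unital_jb_algebra"
  shows "jpower a m \<circ>\<^sub>J jpower a n = jpower a (m + n)"
proof (induction n)
  case 0
  then show ?case by (simp add: jprod_one_left jprod_commute[of _ 1])
next
  case (Suc n)
  then show ?case
    using jpower_operator_commute[of a m "jpower a n"] by simp
qed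

section \<open>The polynomial calculus\<close>

declare jprod.zero_left [simp] jprod.zero_right [simp]

lemma jpoly_eq_sum:
  assumes "degree p \<le> n"
  shows "jpoly p A = (\<Sum>i\<le>n. coeff p i *\<^sub>R jpower A i)"
  unfolding jpoly_def
  by (rule sum.mono_neutral_left) (use assms in \<open>auto simp: coeff_eq_0\<close>)

lemma jpoly_add: "jpoly (p + q) A = jpoly p A + jpoly q A"
proof -
  define n where "n = max (degree p) (degree q)"
  have "degree (p + q) \<le> n" "degree p \<le> n" "degree q \<le> n"
    unfolding n_def by (auto intro: degree_add_le)
  then show ?thesis
    by (simp add: jpoly_eq_sum[of _ n] scaleR_add_left sum.distrib)
qed

lemma jpoly_smult: "jpoly (smult c p) A = c *\<^sub>R jpoly p A"
  by (simp add: jpoly_eq_sum[of _ "degree p"] degree_smult_le scaleR_sum_right del: degree_smult_eq)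

lemma jpoly_diff: "jpoly (p - q) A = jpoly p A - jpoly q A"
  using jpoly_add[of p "smult (-1) q" A] jpoly_smult[of "-1" q A] by simp

lemma jpoly_pCons: "jpoly (pCons c p) A = c *\<^sub>R 1 + A \<circ>\<^sub>J jpoly p A"
proof -
  have "degree (pCons c p) \<le> Suc (degree p)"
    by (rule degree_pCons_le)
  then have "jpoly (pCons c p) A = (\<Sum>i\<le>Suc (degree p). coeff (pCons c p) i *\<^sub>R jpower A i)"
    by (rule jpoly_eq_sum)
  also have "\<dots> = c *\<^sub>R 1 + (\<Sum>i\<le>degree p. coeff p i *\<^sub>R (A \<circ>\<^sub>J jpower A i))"
    unfolding sum.atMost_Suc_shift by simp
  also have "\<dots> = c *\<^sub>R 1 + A \<circ>\<^sub>J jpoly p A"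
    by (simp add: jpoly_def jprod.sum_right jprod_scaleR_right)
  finally show ?thesis .
qed

lemma jpoly_0 [simp]: "jpoly 0 A = 0"
  by (simp add: jpoly_def)

lemma jpoly_1 [simp]: "jpoly 1 A = 1"
  by (simp add: jpoly_def)

lemma jpoly_const [simp]: "jpoly [:c:] A = c *\<^sub>R 1"
  by (simp add: jpoly_pCons)

lemma jpoly_mult:
  fixes A :: "'a::unital_jb_algebra"
  shows "jpoly (p * q) A = jpoly p A \<circ>\<^sub>J jpoly q A"
proof (induction p)
  case 0
  then show ?case by simp
next
  case (pCons c p)
  have "(A \<circ>\<^sub>J jpower A i) \<circ>\<^sub>J jpower A j = A \<circ>\<^sub>J (jpower A i \<circ>\<^sub>J jpower A j)" for i j
    using jpower_add[of A "Suc i" j] jpower_add[of A i j] by simp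
  then have "(A \<circ>\<^sub>J jpoly p A) \<circ>\<^sub>J jpoly q A = A \<circ>\<^sub>J (jpoly p A \<circ>\<^sub>J jpoly q A)"
    by (simp add: jpoly_def jprod.sum_right jprod.sum_left jprod_scaleR_right jprod_scaleR_left)
  then show ?case
    by (simp add: jpoly_add jpoly_smult jpoly_pCons pCons.IH jprod_add_left jprod_scaleR_left
        jprod_one_left)
qed

lemma jpoly_pcompose:
  fixes A :: "'a::unital_jb_algebra"
  shows "jpoly (pcompose p q) A = jpoly p (jpoly q A)"
  by (induction p) (simp_all add: pcompose_pCons jpoly_add jpoly_mult jpoly_pCons)

lemma norm_jpoly_mult_le:
  fixes A :: "'a::unital_jb_algebra"
  shows "norm (jpoly (p * q) A) \<le> norm (jpoly p A) * norm (jpoly q A)"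
  by (simp add: jpoly_mult norm_jprod_le)

lemma norm_jpoly_square:
  fixes A :: "'a::unital_jb_algebra"
  shows "norm (jpoly (p\<^sup>2) A) = (norm (jpoly p A))\<^sup>2"
  by (simp add: power2_eq_square[of p] jpoly_mult norm_jsquare)

lemma norm_jpoly_square_le_add:
  fixes A :: "'a::unital_jb_algebra"
  shows "norm (jpoly (p\<^sup>2) A) \<le> norm (jpoly (p\<^sup>2 + q\<^sup>2) A)"
  by (simp add: power2_eq_square jpoly_mult jpoly_add norm_jsquare_le_add)

lemma norm_one_le: "norm (1::'a::unital_jb_algebra) \<le> 1"
proof -
  have "norm (1::'a) * (norm (1::'a) - 1) = 0"
    using norm_jsquare[of "1::'a"] by (simp add: jprod_one_left power2_eq_square algebra_simps)
  then show ?thesis by auto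
qed

lemma norm_jpoly_1_le: "norm (jpoly 1 (A::'a::unital_jb_algebra)) \<le> 1"
  by (simp add: norm_one_le)

section \<open>Approximate eigenvectors of polynomials\<close>

text \<open>
The square root of \<open>1 - x\<close> is \<open>1 - y\<close> for the fixed point \<open>y\<close> of
\<open>y \<mapsto> (x + y\<^sup>2) / 2\<close>, which is a contraction with constant \<open>r\<close> on the ball of radius \<open>r\<close>.
Its iterates starting at \<open>0\<close> are polynomials, and the defect of an iterate as a root is, up to sign,
twice the next increment.  Hence no limit has to be formed, and all the algebra takes place in the
commutative associative ring of polynomials.
\<close>

lemma approx_sqrt_strict:
  fixes A :: "'a::unital_jb_algebra"
  assumes x: "norm (jpoly x A) \<le> r" and r: "r < 1"
  shows "\<exists>y. (\<lambda>n::nat. jpoly (1 - x - (1 - y n)\<^sup>2) A) \<longlonglongrightarrow> 0"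
proof -
  define y where "y = rec_nat (0::real poly) (\<lambda>_ y. smult (1/2) (x + y\<^sup>2))"
  have ys: "y 0 = 0" "y (Suc n) = smult (1/2) (x + (y n)\<^sup>2)" for n
    by (simp_all add: y_def)
  have r0: "0 \<le> r" using x norm_ge_zero order_trans by blast
  have bd: "norm (jpoly (y n) A) \<le> r" for n
  proof (induction n)
    case 0
    then show ?case by (simp add: ys r0)
  next
    case (Suc n)
    have "norm (jpoly (x + (y n)\<^sup>2) A) \<le> r + r\<^sup>2"
      unfolding jpoly_add
      by (rule order_trans[OF norm_triangle_ineq])
         (use x Suc in \<open>simp add: norm_jpoly_square add_mono power_mono\<close>)
    moreover have "r\<^sup>2 \<le> r" using r r0 by (simp add: power2_eq_square mult_left_le)
    ultimately show ?case by (simp add: ys jpoly_smult)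
  qed
  have step: "norm (jpoly (y (Suc n) - y n) A) \<le> r ^ n * r" for n
  proof (induction n)
    case 0
    then show ?case using x r0 by (simp add: ys jpoly_smult)
  next
    case (Suc n)
    have e: "y (Suc (Suc n)) - y (Suc n) = smult (1/2) ((y (Suc n) - y n) * (y (Suc n) + y n))"
      by (subst (1 2) ys(2))
        (simp add: algebra_simps power2_eq_square smult_add_right[symmetric]
          smult_diff_right[symmetric] del: smult_add_right smult_diff_right)
    have "norm (jpoly ((y (Suc n) - y n) * (y (Suc n) + y n)) A)
       \<le> norm (jpoly (y (Suc n) - y n) A) * norm (jpoly (y (Suc n) + y n) A)"
      by (rule norm_jpoly_mult_le)
    also have "\<dots> \<le> (r ^ n * r) * (r + r)"
      unfolding jpoly_add
      by (intro mult_mono Suc order_trans[OF norm_triangle_ineq] add_mono bd) (use r0 in auto)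
    finally show ?case unfolding e by (simp add: jpoly_smult algebra_simps)
  qed
  have "(\<lambda>n. r ^ n * r) \<longlonglongrightarrow> 0"
    using LIMSEQ_realpow_zero[OF r0 r] tendsto_mult_left_zero by blast
  then have "(\<lambda>n. jpoly (y (Suc n) - y n) A) \<longlonglongrightarrow> 0"
    by (rule Lim_null_comparison[rotated]) (use step in auto)
  then have "(\<lambda>n. -2 *\<^sub>R jpoly (y (Suc n) - y n) A) \<longlonglongrightarrow> -2 *\<^sub>R 0"
    by (intro tendsto_intros)
  moreover have eq: "1 - x - (1 - y n)\<^sup>2 = smult (-2) (y (Suc n) - y n)" for n
  proof -
    have "smult 2 (y (Suc n)) = x + (y n)\<^sup>2" "smult 2 (y n) = 2 * y n"
      by (simp_all add: ys numeral_poly)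
    then show ?thesis
      by (simp add: smult_diff_right power2_eq_square algebra_simps)
  qed
  ultimately have "(\<lambda>n. jpoly (1 - x - (1 - y n)\<^sup>2) A) \<longlonglongrightarrow> 0"
    unfolding eq jpoly_smult by simp
  then show ?thesis by blast
qed

lemma approx_sqrt:
  fixes A :: "'a::unital_jb_algebra"
  assumes x: "norm (jpoly x A) \<le> 1" and e: "e > 0"
  obtains y where "norm (jpoly (1 - x - y\<^sup>2) A) < e"
proof -
  \<comment> \<open>the contraction needs a norm below \<open>1\<close>, so \<open>x\<close> is first shrunk by a factor \<open>r\<close> close to \<open>1\<close>\<close>
  define r where "r = 1 - min (e/3) (1/2)"
  have r: "0 < r" "r < 1" "1 - r < e/2" using e by (auto simp: r_def)
  have "norm (jpoly (smult r x) A) \<le> r"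
    using x r by (simp add: jpoly_smult mult_left_le)
  then obtain y where "(\<lambda>n::nat. jpoly (1 - smult r x - (1 - y n)\<^sup>2) A) \<longlonglongrightarrow> 0"
    using approx_sqrt_strict[of "smult r x" A r] r by blast
  then have "\<forall>\<^sub>F n in sequentially. dist (jpoly (1 - smult r x - (1 - y n)\<^sup>2) A) 0 < e/2"
    using e by (intro tendstoD) auto
  then obtain n where n: "norm (jpoly (1 - smult r x - (1 - y n)\<^sup>2) A) < e/2"
    by (auto simp: eventually_sequentially)
  have "1 - x - (1 - y n)\<^sup>2 = (1 - smult r x - (1 - y n)\<^sup>2) - smult (1 - r) x"
    by (simp add: smult_diff_left)
  then have "norm (jpoly (1 - x - (1 - y n)\<^sup>2) A) \<le>
      norm (jpoly (1 - smult r x - (1 - y n)\<^sup>2) A) + norm (jpoly (smult (1 - r) x) A)"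
    by (metis jpoly_diff norm_triangle_ineq4)
  also have "norm (jpoly (smult (1 - r) x) A) < e/2"
  proof -
    have "(1 - r) * norm (jpoly x A) \<le> (1 - r) * 1"
      by (rule mult_left_mono) (use x r in auto)
    also have "\<dots> < e / 2" using r(3) by simp
    finally have "(1 - r) * norm (jpoly x A) < e / 2" .
    then show ?thesis using r by (simp add: jpoly_smult)
  qed
  finally show thesis
    by (intro that[of "1 - y n"]) (use n in linarith)
qed

text \<open>
As \<open>1 - x\<close> is a limit of squares, so is \<open>a\<^sup>2 * (1 - x)\<close>, and the axiom
\<open>\<parallel>P\<^sup>2\<parallel> \<le> \<parallel>P\<^sup>2 + Q\<^sup>2\<parallel>\<close> carries over to the limit.
\<close>

lemma norm_jpoly_mono:
  fixes A :: "'a::unital_jb_algebra"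
  assumes x: "norm (jpoly x A) \<le> 1"
  shows "norm (jpoly (a\<^sup>2 * (1 - x)) A) \<le> norm (jpoly (a\<^sup>2 * (1 - x) + b\<^sup>2) A)"
proof (rule field_le_epsilon)
  fix e :: real assume e: "e > 0"
  define M where "M = norm (jpoly (a\<^sup>2) A)"
  have M: "M \<ge> 0" by (simp add: M_def)
  obtain y where y: "norm (jpoly (1 - x - y\<^sup>2) A) < e / (2 * (M + 1))"
    using approx_sqrt[OF x, of "e / (2 * (M + 1))"] e M by auto
  define d where "d = a\<^sup>2 * (1 - x - y\<^sup>2)"
  have "norm (jpoly d A) \<le> M * (e / (2 * (M + 1)))"
    unfolding d_def M_def
    by (rule order_trans[OF norm_jpoly_mult_le], rule mult_left_mono) (use y in \<open>auto simp: M_def\<close>)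
  also have "\<dots> \<le> e / 2"
    using M e by (simp add: field_simps)
  finally have d: "norm (jpoly d A) \<le> e / 2" .
  have eq: "a\<^sup>2 * (1 - x) = (a * y)\<^sup>2 + d" "a\<^sup>2 * (1 - x) + b\<^sup>2 = ((a * y)\<^sup>2 + b\<^sup>2) + d"
    by (simp_all add: d_def algebra_simps power2_eq_square)
  have "norm (jpoly (a\<^sup>2 * (1 - x)) A) \<le> norm (jpoly ((a * y)\<^sup>2) A) + norm (jpoly d A)"
    unfolding eq by (simp only: jpoly_add norm_triangle_ineq)
  also have "norm (jpoly ((a * y)\<^sup>2) A) \<le> norm (jpoly ((a * y)\<^sup>2 + b\<^sup>2) A)"
    by (rule norm_jpoly_square_le_add)
  also have "\<dots> \<le> norm (jpoly (a\<^sup>2 * (1 - x) + b\<^sup>2) A) + norm (jpoly d A)"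
    unfolding eq(2) jpoly_add[of _ d] using norm_triangle_ineq4[of "jpoly ((a * y)\<^sup>2 + b\<^sup>2) A + jpoly d A" "jpoly d A"]
    by simp
  finally show "norm (jpoly (a\<^sup>2 * (1 - x)) A) \<le> norm (jpoly (a\<^sup>2 * (1 - x) + b\<^sup>2) A) + e"
    using d by simp
qed

text \<open>
With \<open>u = d\<^sup>2\<close>, which behaves like a function with values in \<open>[0, 1]\<close>, this is the estimate
\<open>(1 - u) u\<^bsup>k\<^esup> = O(1/k)\<close> along \<open>k = 2\<^bsup>m\<^esup> - 1\<close>.  As \<open>u\<^bsup>k\<^esup>\<close> has norm at least \<open>1\<close>
when \<open>\<parallel>d\<parallel> = 1\<close>, these powers are then approximate eigenvectors of \<open>u\<close> for the eigenvalue \<open>1\<close>.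
Summing the geometric series would require a comparison with sums of many squares; doubling the
exponent only needs one square at a time:
\<open>u\<^bsup>2k\<^esup> (1 - u\<^sup>2) = 2 u\<^bsup>2k+1\<^esup> (1 - u) + (u\<^bsup>k\<^esup> (1 - u))\<^sup>2\<close>.
\<close>

lemma norm_jpoly_approx_eigen:
  fixes A :: "'a::unital_jb_algebra"
  assumes "norm (jpoly d A) \<le> 1"
  shows "2 ^ m * norm (jpoly ((d\<^sup>2) ^ (2 ^ m - 1) * (1 - d\<^sup>2)) A) \<le> 1"
  using assms
proof (induction m arbitrary: d)
  case 0
  have "norm (jpoly (1\<^sup>2 * (1 - d\<^sup>2)) A) \<le> norm (jpoly (1\<^sup>2 * (1 - d\<^sup>2) + d\<^sup>2) A)"
    by (rule norm_jpoly_mono) (use 0 in \<open>simp add: norm_jpoly_square power_le_one\<close>)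
  also have "\<dots> \<le> 1"
    using norm_jpoly_1_le by simp
  finally show ?case by simp
next
  case (Suc m)
  define k where "k = (2::nat) ^ m - 1"
  define u where "u = d\<^sup>2"
  have u: "norm (jpoly u A) \<le> 1"
    using Suc.prems by (simp add: u_def norm_jpoly_square power_le_one)
  have k: "2 ^ Suc m - 1 = Suc (2 * k)" 
  proof -
    have "(2::nat) ^ m \<ge> 1" by simp
    then show ?thesis unfolding k_def power_Suc by linarith
  qed
  \<comment> \<open>the summands of the doubling identity are \<open>a\<^sup>2 * (1 - u)\<close> and \<open>b\<^sup>2\<close>\<close>
  define a b where "a = smult (sqrt 2) (d ^ Suc (2 * k))" and "b = d ^ (2 * k) * (1 - u)"
  have a2: "a\<^sup>2 = smult 2 (u ^ Suc (2 * k))"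
    unfolding a_def u_def poly_eq_poly_eq_iff[symmetric]
    by (rule ext) (simp add: power_mult_distrib power_mult[symmetric] mult.commute del: power_Suc)
  have "b = u ^ k * (1 - u)"
    by (simp add: b_def u_def power_mult)
  moreover have "u ^ Suc (2 * k) = u * (u ^ k)\<^sup>2" "(u\<^sup>2) ^ k = (u ^ k)\<^sup>2"
    by (simp_all add: power_mult[symmetric] mult.commute)
  ultimately have "a\<^sup>2 * (1 - u) + b\<^sup>2 = (u\<^sup>2) ^ k * (1 - u\<^sup>2)"
    unfolding a2 poly_eq_poly_eq_iff[symmetric]
    by (intro ext) (simp add: algebra_simps power2_eq_square)
  then have "2 * norm (jpoly (u ^ Suc (2 * k) * (1 - u)) A) \<le> norm (jpoly ((u\<^sup>2) ^ k * (1 - u\<^sup>2)) A)"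
    using norm_jpoly_mono[OF u, of a b] a2 by (simp add: jpoly_smult)
  also have "2 ^ m * \<dots> \<le> 1"
    using Suc.IH[OF u] by (simp add: k_def)
  finally have "2 ^ m * (2 * norm (jpoly (u ^ Suc (2 * k) * (1 - u)) A)) \<le> 1"
    by simp
  then show ?case unfolding k u_def[symmetric] by (simp add: mult.assoc mult.left_commute)
qed

section \<open>The spectral norm formula\<close>

text \<open>
A form of invertibility of \<open>r(A)\<close> that sees only the polynomials in \<open>A\<close>: it passes to
products without any question of how inverses multiply, and it is incompatible with approximate
eigenvectors of \<open>r(A)\<close> for the eigenvalue \<open>0\<close> among the polynomials in \<open>A\<close>.
\<close>

definition jbounded_below :: "real poly \<Rightarrow> 'a::unital_jb_algebra \<Rightarrow> bool" where
  "jbounded_below r A \<longleftrightarrow> (\<exists>c\<ge>0. \<forall>q. norm (jpoly q A) \<le> c * norm (jpoly (r * q) A))"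

lemma jbounded_below_mult:
  fixes A :: "'a::unital_jb_algebra"
  assumes "jbounded_below r A" "jbounded_below s A"
  shows "jbounded_below (r * s) A"
proof -
  obtain c c' where c: "c \<ge> 0" "\<And>q. norm (jpoly q A) \<le> c * norm (jpoly (r * q) A)"
    and c': "c' \<ge> 0" "\<And>q. norm (jpoly q A) \<le> c' * norm (jpoly (s * q) A)"
    using assms unfolding jbounded_below_def by blast
  have "norm (jpoly q A) \<le> (c' * c) * norm (jpoly (r * s * q) A)" for q
    using order_trans[OF c'(2)[of q] mult_left_mono[OF c(2)[of "s * q"] c'(1)]]
    by (simp add: mult.assoc)
  then show ?thesis unfolding jbounded_below_def using c c' by (intro exI[of _ "c' * c"]) simp
qed

text \<open>
A Jordan inverse need not be a limit of polynomials in \<open>T\<close>, so its multiplication with powers of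
\<open>T\<close> is not covered by power associativity.  Applying the operator recursion for powers to the inverse
itself gives the cancellation.
\<close>

lemma jinverse_cancel:
  fixes T :: "'a::unital_jb_algebra"
  assumes E: "T \<circ>\<^sub>J E = 1" "(T \<circ>\<^sub>J T) \<circ>\<^sub>J E = T"
  shows "E \<circ>\<^sub>J (T \<circ>\<^sub>J jpower T n) = jpower T n"
proof (induction n rule: less_induct)
  case (less n)
  consider "n = 0" | m where "n = Suc m"
    by (metis not0_implies_Suc)
  then show ?case
  proof cases
    case 1
    then show ?thesis using E by (simp add: jprod_commute[of _ 1] jprod_one_left jprod_commute[of E])
  next
    case 2
    have one: "jpower T k \<circ>\<^sub>J 1 = jpower T k" "T \<circ>\<^sub>J 1 = T" for k
      by (simp_all add: jprod_commute[of _ 1] jprod_one_left)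
    have com: "jpower T m \<circ>\<^sub>J (T \<circ>\<^sub>J x) = T \<circ>\<^sub>J (jpower T m \<circ>\<^sub>J x)"
       "jpower T m \<circ>\<^sub>J ((T \<circ>\<^sub>J T) \<circ>\<^sub>J x) = (T \<circ>\<^sub>J T) \<circ>\<^sub>J (jpower T m \<circ>\<^sub>J x)" for x
      using jpower_operator_commute by blast+
    have 1: "T \<circ>\<^sub>J (T \<circ>\<^sub>J (jpower T m \<circ>\<^sub>J E)) = jpower T (Suc m)"
      by (simp add: com[symmetric] E one com(1)[of 1, unfolded one])
    have 2: "(T \<circ>\<^sub>J T) \<circ>\<^sub>J (jpower T m \<circ>\<^sub>J E) = jpower T (Suc m)"
      by (simp add: com[symmetric] E one com(1)[of 1, unfolded one])
    have 3: "jpower T m \<circ>\<^sub>J (T \<circ>\<^sub>J (T \<circ>\<^sub>J E)) = jpower T (Suc m)"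
      unfolding E one jpower.simps by (rule jprod_commute)
    have "jpower T (Suc (Suc m)) \<circ>\<^sub>J E = jpower T (Suc m)"
      unfolding jpower_Suc_Suc_operator 1 2 3 unfolding E(1) one by (simp add: scaleR_2)
    then show ?thesis using 2 \<open>n = Suc m\<close> by (simp add: jprod_commute)
  qed
qed

lemma jbounded_below_linear:
  fixes A :: "'a::unital_jb_algebra"
  assumes "r \<notin> jspectrum A"
  shows "jbounded_below [:- r, 1:] A"
proof -
  define T where "T = A - r *\<^sub>R 1"
  obtain E where E: "T \<circ>\<^sub>J E = 1" "(T \<circ>\<^sub>J T) \<circ>\<^sub>J E = T"
    using assms by (auto simp: jspectrum_def jinvertible_def T_def)
  have T: "T = jpoly [:- r, 1:] A" and A: "A = jpoly [:r, 1:] T"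
    by (simp_all add: T_def jpoly_pCons jprod_commute[of _ 1] jprod_one_left)
  have "norm (jpoly q A) \<le> norm E * norm (jpoly ([:- r, 1:] * q) A)" for q
  proof -
    define q' where "q' = pcompose q [:r, 1:]"
    have q: "jpoly q A = jpoly q' T"
      unfolding q'_def jpoly_pcompose A[symmetric] ..
    have "E \<circ>\<^sub>J (T \<circ>\<^sub>J jpoly q' T) = jpoly q' T"
      by (simp add: jpoly_def jprod.sum_right jprod_scaleR_right jinverse_cancel[OF E])
    then have "norm (jpoly q' T) \<le> norm E * norm (T \<circ>\<^sub>J jpoly q' T)"
      by (metis norm_jprod_le)
    then show ?thesis
      unfolding jpoly_mult T[symmetric] q .
  qed
  then show ?thesis
    unfolding jbounded_below_def by (intro exI[of _ "norm E"]) auto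
qed

text \<open>
This is where the spectrum is forced to be real.  In
\<open>((A - a)\<^sup>2 + b\<^sup>2) q(A)\<^sup>2\<close> both summands are squares, so the norm is at least
\<open>b\<^sup>2 \<parallel>q(A)\<parallel>\<^sup>2\<close>.
\<close>

lemma jbounded_below_quadratic:
  fixes A :: "'a::unital_jb_algebra"
  assumes b: "b \<noteq> 0"
  shows "jbounded_below ([:- a, 1:]\<^sup>2 + [:b\<^sup>2:]) A"
proof -
  define m where "m = [:- a, 1:]\<^sup>2 + [:b\<^sup>2:]"
  have "norm (jpoly q A) \<le> (1 / b\<^sup>2) * norm (jpoly (m * q) A)" for q
  proof (cases "norm (jpoly q A) = 0")
    case False
    then have pos: "norm (jpoly q A) > 0" by simp
    have e: "(m * q) * q = (smult b q)\<^sup>2 + ([:- a, 1:] * q)\<^sup>2"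
      unfolding poly_eq_poly_eq_iff[symmetric] m_def
      by (rule ext) (simp add: power2_eq_square algebra_simps)
    have "b\<^sup>2 * (norm (jpoly q A))\<^sup>2 = norm (jpoly ((smult b q)\<^sup>2) A)"
      by (simp add: norm_jpoly_square jpoly_smult power_mult_distrib)
    also have "\<dots> \<le> norm (jpoly ((m * q) * q) A)"
      unfolding e by (rule norm_jpoly_square_le_add)
    also have "\<dots> \<le> norm (jpoly (m * q) A) * norm (jpoly q A)"
      by (rule norm_jpoly_mult_le)
    finally have "b\<^sup>2 * norm (jpoly q A) \<le> norm (jpoly (m * q) A)"
      using pos by (simp add: power2_eq_square)
    then show ?thesis using b by (simp add: field_simps)
  qed (use b in simp)
  then show ?thesis
    unfolding jbounded_below_def m_def by (intro exI[of _ "1 / b\<^sup>2"]) auto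
qed

lemma poly_map_of_real_of_real:
  "poly (map_poly complex_of_real p) (of_real x) = of_real (poly p x)"
  by (induction p) (simp_all add: map_poly_pCons)

lemma poly_map_of_real_add:
  "poly (map_poly complex_of_real (p + q)) z = poly (map_poly of_real p) z + poly (map_poly of_real q) z"
  by (induction p q rule: poly_induct2) (simp_all add: map_poly_pCons algebra_simps)

lemma poly_map_of_real_mult:
  "poly (map_poly complex_of_real (p * q)) z = poly (map_poly of_real p) z * poly (map_poly of_real q) z"
proof -
  have smult: "poly (map_poly complex_of_real (smult c q)) z = of_real c * poly (map_poly of_real q) z" for c
    by (induction q) (simp_all add: map_poly_pCons algebra_simps)
  show ?thesis
    by (induction p) (simp_all add: map_poly_pCons poly_map_of_real_add smult algebra_simps)
qed

text \<open>
A nonreal complex root \<open>z\<close> gives the quadratic factor with roots \<open>z\<close> and its conjugate: the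
remainder modulo this factor has degree at most one and vanishes at \<open>z\<close>.
\<close>

lemma real_poly_factor:
  fixes r :: "real poly"
  assumes "degree r > 0"
  obtains a where "poly r a = 0" | a b where "b \<noteq> 0" "([:- a, 1:]\<^sup>2 + [:b\<^sup>2:]) dvd r"
proof -
  have "\<not> constant (poly (map_poly complex_of_real r))"
    using assms by (simp add: constant_degree degree_map_poly)
  then obtain z where z: "poly (map_poly complex_of_real r) z = 0"
    using fundamental_theorem_of_algebra by blast
  show thesis
  proof (cases "Im z = 0")
    case True
    then have "z = complex_of_real (Re z)" by (simp add: complex_eq_iff)
    then have "poly r (Re z) = 0"
      using z poly_map_of_real_of_real[of r "Re z"] by simp
    then show thesis using that(1) by blast
  next
    case False
    define m where "m = [:- Re z, 1:]\<^sup>2 + [:(Im z)\<^sup>2:]"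
    have m: "m = [:(Re z)\<^sup>2 + (Im z)\<^sup>2, - 2 * Re z, 1:]"
      by (simp add: m_def power2_eq_square)
    have mz: "poly (map_poly complex_of_real m) z = 0"
      by (simp add: m complex_eq_iff power2_eq_square algebra_simps map_poly_pCons)
    define s where "s = r mod m"
    have "degree s < 2 \<or> s = 0"
      unfolding s_def using degree_mod_less[of m r] by (auto simp: m)
    then have "degree s \<le> 1" by auto
    then have "s = [:coeff s 0, coeff s 1:]"
      by (intro poly_eqI) (auto simp: coeff_pCons coeff_eq_0 split: nat.splits)
    then obtain c0 c1 where s: "s = [:c0, c1:]"
      by blast
    have "r = r div m * m + s" by (simp add: s_def)
    then have "poly (map_poly complex_of_real s) z = 0"
      using z mz by (metis poly_map_of_real_add poly_map_of_real_mult mult_zero_right add_0)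
    then have "c1 * Im z = 0" "c0 + c1 * Re z = 0"
      by (simp_all add: s complex_eq_iff map_poly_pCons mult.commute)
    then have "s = 0" using False by (simp add: s)
    then show thesis using that(2)[OF False, of "Re z"] by (simp add: m_def[symmetric] s_def dvd_eq_mod_eq_0)
  qed
qed

lemma jbounded_below_if_no_spectral_root:
  fixes A :: "'a::unital_jb_algebra"
  assumes "r \<noteq> 0" and "\<forall>x\<in>jspectrum A. poly r x \<noteq> 0"
  shows "jbounded_below r A"
  using assms
proof (induction "degree r" arbitrary: r rule: less_induct)
  case less
  show ?case
  proof (cases "degree r = 0")
    case True
    then obtain c where "r = [:c:]" using degree_eq_zeroE by blast
    then show ?thesis using less.prems
      unfolding jbounded_below_def by (intro exI[of _ "1 / \<bar>c\<bar>"]) (auto simp: jpoly_smult)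
  next
    case False
    have *: ?thesis if "r = m * s" "degree m > 0" "jbounded_below m A" for m s
    proof -
      have "degree s < degree r" "s \<noteq> 0"
        using less.prems that by (auto simp: degree_mult_eq)
      then have "jbounded_below s A"
        using less.prems that by (intro less.hyps) auto
      then show ?thesis using that jbounded_below_mult by blast
    qed
    have "degree r > 0" using False by simp
    show ?thesis
    proof (rule real_poly_factor[OF \<open>degree r > 0\<close>])
      fix a assume 1: "poly r a = 0"
      then obtain s where "r = [:- a, 1:] * s" by (auto simp: poly_eq_0_iff_dvd)
      moreover have "a \<notin> jspectrum A" using 1 less.prems by blast
      ultimately show ?thesis by (intro *[of "[:- a, 1:]" s] jbounded_below_linear) auto
    next
      fix a b :: real assume 2: "b \<noteq> 0" "[:- a, 1:]\<^sup>2 + [:b\<^sup>2:] dvd r"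
      then obtain s where "r = ([:- a, 1:]\<^sup>2 + [:b\<^sup>2:]) * s" by auto
      then show ?thesis using 2 by (intro *[of "[:- a, 1:]\<^sup>2 + [:b\<^sup>2:]" s] jbounded_below_quadratic) (auto simp: power2_eq_square)
    qed
  qed
qed

text \<open>
If \<open>d = p / \<parallel>p(A)\<parallel>\<close> never has absolute value \<open>1\<close> on the spectrum, then
\<open>1 - d\<^sup>2\<close> is bounded below, against the approximate eigenvectors of \<open>d(A)\<^sup>2\<close>.  For a
constant \<open>p\<close> the polynomial \<open>1 - d\<^sup>2\<close> can be zero, and the claim then is that the spectrum is
nonempty; the second hypothesis keeps this case apart, and the nonconstant case settles it in turn.
\<close>

lemma norm_jpoly_attained_aux:
  fixes A :: "'a::unital_jb_algebra"
  assumes s: "norm (jpoly p A) > 0" and nc: "degree p > 0 \<or> jspectrum A \<noteq> {}"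
  shows "\<exists>x\<in>jspectrum A. \<bar>poly p x\<bar> = norm (jpoly p A)"
proof (rule ccontr)
  define s where "s = norm (jpoly p A)"
  have s: "s > 0" using assms by (simp add: s_def)
  define d where "d = smult (1 / s) p"
  have d: "norm (jpoly d A) = 1" using s by (simp add: d_def jpoly_smult s_def)
  assume "\<not> ?thesis"
  then have "\<forall>x\<in>jspectrum A. \<bar>poly d x\<bar> \<noteq> 1"
    using s by (auto simp: d_def s_def abs_mult)
  then have nz: "\<forall>x\<in>jspectrum A. poly (1 - d\<^sup>2) x \<noteq> 0"
    by (auto simp: power2_eq_1_iff)
  have "jbounded_below (1 - d\<^sup>2) A"
  proof (rule jbounded_below_if_no_spectral_root)
    show "1 - d\<^sup>2 \<noteq> 0"
    proof
      assume "1 - d\<^sup>2 = 0"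
      then have "d\<^sup>2 = 1" by simp
      then have "d = 1 \<or> d = - 1" by (simp add: power2_eq_1_iff)
      then have "degree d = 0" by auto
      then have "degree p = 0" using s by (simp add: d_def)
      then show False using nc nz \<open>1 - d\<^sup>2 = 0\<close> by auto
    qed
  qed (use nz in auto)
  then obtain c where c: "c \<ge> 0" "\<And>q. norm (jpoly q A) \<le> c * norm (jpoly ((1 - d\<^sup>2) * q) A)"
    unfolding jbounded_below_def by blast
  have "2 ^ m \<le> c" for m :: nat
  proof -
    define x where "x = (d\<^sup>2) ^ (2 ^ m - 1)"
    \<comment> \<open>repeated squaring preserves the norm \<open>1\<close>; the exponent \<open>2 ^ m - 1\<close> is compared with a power of two below\<close>
    have one: "norm (jpoly (d ^ (2 ^ j)) A) = 1" for j
    proof (induction j)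
      case (Suc j)
      have "d ^ (2 ^ Suc j) = (d ^ (2 ^ j))\<^sup>2" by (simp add: power_mult[symmetric] mult.commute)
      then show ?case using Suc by (simp add: norm_jpoly_square)
    qed (simp add: d)
    have "x * d\<^sup>2 = d ^ (2 ^ Suc m)"
      unfolding x_def power_mult[symmetric] power_add[symmetric] 
    proof (intro arg_cong[of _ _ "\<lambda>n. d ^ n"])
      have "(2::nat) ^ m \<ge> 1" by simp
      then show "2 * (2 ^ m - 1) + 2 = (2::nat) ^ Suc m"
        unfolding power_Suc by linarith
    qed
    then have "1 \<le> norm (jpoly x A)"
      using one[of "Suc m"] norm_jpoly_mult_le[of x "d\<^sup>2" A] by (simp add: norm_jpoly_square d)
    also have "\<dots> \<le> c * norm (jpoly (x * (1 - d\<^sup>2)) A)"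
      using c(2)[of x] by (simp add: mult.commute)
    finally have "2 ^ m * 1 \<le> 2 ^ m * (c * norm (jpoly (x * (1 - d\<^sup>2)) A))"
      by (intro mult_left_mono) auto
    also have "\<dots> \<le> c * (2 ^ m * norm (jpoly (x * (1 - d\<^sup>2)) A))"
      by simp
    also have "\<dots> \<le> c * 1"
      using norm_jpoly_approx_eigen[of d A m] d c(1) by (intro mult_left_mono) (auto simp: x_def)
    finally show ?thesis by simp
  qed
  moreover obtain m where "c < 2 ^ m"
    using real_arch_pow[of 2 c] by auto
  ultimately show False by (metis not_less)
qed

lemma jspectrum_nonempty:
  fixes A :: "'a::unital_jb_algebra"
  assumes "(1::'a) \<noteq> 0"
  shows "jspectrum A \<noteq> {}"
proof (cases "A = 0")
  case True
  have "\<not> jinvertible (A - 0 *\<^sub>R 1)"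
    using assms True by (simp add: jinvertible_def)
  then have "0 \<in> jspectrum A" unfolding jspectrum_def mem_Collect_eq .
  then show ?thesis by blast
next
  case False
  have "jpoly [:0, 1:] A = A"
    by (simp add: jpoly_pCons jprod_commute[of _ 1] jprod_one_left)
  then show ?thesis
    using norm_jpoly_attained_aux[of "[:0, 1:]" A] False by auto
qed

text \<open>
Together with its consequence for suprema, this replaces the isometry of the closed subalgebra
generated by \<open>A\<close> and the unit with the continuous functions on the spectrum.
\<close>

theorem norm_jpoly_attained:
  fixes A :: "'a::unital_jb_algebra"
  assumes "jpoly p A \<noteq> 0"
  shows "\<exists>x\<in>jspectrum A. \<bar>poly p x\<bar> = norm (jpoly p A)"
proof -
  have "(1::'a) \<noteq> 0"
    using assms jprod_one_left[of "jpoly p A"] by auto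
  then show ?thesis
    using norm_jpoly_attained_aux[of p A] jspectrum_nonempty assms by auto
qed

lemma norm_jpoly_le:
  fixes A :: "'a::unital_jb_algebra"
  assumes "\<And>x. x \<in> jspectrum A \<Longrightarrow> \<bar>poly p x\<bar> \<le> e" and "e \<ge> 0"
  shows "norm (jpoly p A) \<le> e"
  using norm_jpoly_attained[of p A] assms by (cases "jpoly p A = 0") (simp, metis)

section \<open>The functional calculus\<close>

lemma jpoly_X: "jpoly [:0, 1:] A = A"
  by (simp add: jpoly_pCons jprod_commute[of _ 1] jprod_one_left)

lemma jpoly_sum: "jpoly (sum f I) A = (\<Sum>i\<in>I. jpoly (f i) A)"
  by (induction I rule: infinite_finite_induct) (simp_all add: jpoly_add)

lemma norm_jpoly_power_le:
  fixes A :: "'a::unital_jb_algebra"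
  shows "norm (jpoly (p ^ n) A) \<le> norm (jpoly p A) ^ n"
proof (induction n)
  case (Suc n)
  then show ?case
    using order_trans[OF norm_jpoly_mult_le[of p "p ^ n" A] mult_left_mono[OF Suc]] by simp
qed (simp add: norm_one_le)

text \<open>
For \<open>\<bar>r\<bar> > \<parallel>A\<parallel>\<close> the Neumann series is a limit of polynomials \<open>g n\<close> in \<open>A\<close>, so
both equations for a Jordan inverse can be checked on polynomials and passed to the limit.
\<close>

lemma jspectrum_bound:
  fixes A :: "'a::unital_jb_algebra"
  assumes "r \<in> jspectrum A"
  shows "\<bar>r\<bar> \<le> norm A"
proof (rule ccontr)
  assume "\<not> ?thesis"
  then have r: "norm A < \<bar>r\<bar>" "r \<noteq> 0" by auto
  define T where "T = A - r *\<^sub>R 1"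
  have T: "T = jpoly [:- r, 1:] A"
    by (simp add: T_def jpoly_pCons jprod_commute[of _ 1] jprod_one_left)
  define x where "x = smult (1 / r) [:0, 1::real:]"
  have x: "norm (jpoly x A) < 1"
    unfolding x_def jpoly_smult jpoly_X using r by simp
  define g where "g n = smult (- 1 / r) (\<Sum>i<n. x ^ i)" for n
  have g: "[:- r, 1:] * g n = 1 - x ^ n" for n
  proof -
    have "[:- r, 1:] = smult (- r) (1 - x)"
      unfolding poly_eq_poly_eq_iff[symmetric] using r by (intro ext) (simp add: x_def field_simps)
    then have "[:- r, 1:] * g n = (1 - x) * (\<Sum>i<n. x ^ i)"
      using r by (simp add: g_def)
    then show ?thesis by (simp add: one_diff_power_eq)
  qed
  have "(\<lambda>n. norm (jpoly x A) ^ n) \<longlonglongrightarrow> 0"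
    using x by (intro LIMSEQ_realpow_zero) auto
  then have null: "(\<lambda>n. jpoly (x ^ n) A) \<longlonglongrightarrow> 0"
    by (rule Lim_null_comparison[rotated]) (simp add: norm_jpoly_power_le)
  have "summable (\<lambda>n. norm (jpoly x A) ^ n)"
    using x by (intro summable_geometric) auto
  then have "summable (\<lambda>n. jpoly (x ^ n) A)"
    by (rule summable_comparison_test'[where N = 0]) (simp add: norm_jpoly_power_le)
  then obtain S where "(\<lambda>n. \<Sum>i<n. jpoly (x ^ i) A) \<longlonglongrightarrow> S"
    by (auto simp: summable_def sums_def)
  then have "(\<lambda>n. (- 1 / r) *\<^sub>R (\<Sum>i<n. jpoly (x ^ i) A)) \<longlonglongrightarrow> (- 1 / r) *\<^sub>R S"
    by (intro tendsto_intros)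
  then obtain E where E: "(\<lambda>n. jpoly (g n) A) \<longlonglongrightarrow> E"
    unfolding g_def jpoly_smult jpoly_sum by blast
  have "(\<lambda>n. T \<circ>\<^sub>J jpoly (g n) A) \<longlonglongrightarrow> T \<circ>\<^sub>J E"
    by (intro jprod.tendsto tendsto_const E)
  moreover have Tg: "T \<circ>\<^sub>J jpoly (g n) A = 1 - jpoly (x ^ n) A" for n
    unfolding T jpoly_mult[symmetric] g by (simp add: jpoly_diff)
  moreover have lim: "(\<lambda>n. 1 - jpoly (x ^ n) A) \<longlonglongrightarrow> 1 - 0"
    by (intro tendsto_intros null)
  ultimately have 1: "T \<circ>\<^sub>J E = 1"
    using LIMSEQ_unique by fastforce
  have "(\<lambda>n. (T \<circ>\<^sub>J T) \<circ>\<^sub>J jpoly (g n) A) \<longlonglongrightarrow> (T \<circ>\<^sub>J T) \<circ>\<^sub>J E"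
    by (intro jprod.tendsto tendsto_const E)
  moreover have "(T \<circ>\<^sub>J T) \<circ>\<^sub>J jpoly (g n) A = T \<circ>\<^sub>J (1 - jpoly (x ^ n) A)" for n
    unfolding Tg[symmetric] unfolding T jpoly_mult[symmetric] by (simp only: mult.assoc)
  moreover have "(\<lambda>n. T \<circ>\<^sub>J (1 - jpoly (x ^ n) A)) \<longlonglongrightarrow> T \<circ>\<^sub>J (1 - 0)"
    by (intro jprod.tendsto tendsto_const lim)
  ultimately have "(T \<circ>\<^sub>J T) \<circ>\<^sub>J E = T \<circ>\<^sub>J (1 - 0)"
    using LIMSEQ_unique by fastforce
  then have "jinvertible T"
    using 1 by (auto simp: jinvertible_def jprod_commute[of _ 1] jprod_one_left)
  then show False using assms by (simp add: jspectrum_def T_def)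
qed

lemma jspectrum_subset_Icc:
  fixes A :: "'a::unital_jb_algebra"
  assumes "norm (A - c *\<^sub>R 1) \<le> d"
  shows "jspectrum A \<subseteq> {c - d..c + d}"
proof
  fix r assume "r \<in> jspectrum A"
  then have "r - c \<in> jspectrum (A - c *\<^sub>R 1)"
    by (simp add: jspectrum_def algebra_simps)
  then have "\<bar>r - c\<bar> \<le> d"
    using jspectrum_bound assms by (meson order_trans)
  then show "r \<in> {c - d..c + d}" by auto
qed

text \<open>
The relation under the definite description in \<open>jfun_calc\<close>.
\<close>

definition has_jfun_calc :: "(real \<Rightarrow> real) \<Rightarrow> 'a::unital_jb_algebra \<Rightarrow> 'a \<Rightarrow> bool" where
  "has_jfun_calc f A B \<longleftrightarrow> (\<exists>p :: nat \<Rightarrow> real poly.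
     uniform_limit (jspectrum A) (\<lambda>n. poly (p n)) f sequentially \<and>
     (\<lambda>n. jpoly (p n) A) \<longlonglongrightarrow> B)"

text \<open>
The workhorse below: it gives uniqueness of the functional calculus, and it turns scalar estimates
on the spectrum into norm estimates.
\<close>

lemma has_jfun_calc_norm_diff_le:
  fixes A :: "'a::unital_jb_algebra"
  assumes f: "has_jfun_calc f A B" and g: "has_jfun_calc g A C"
    and e: "e \<ge> 0" "\<And>x. x \<in> jspectrum A \<Longrightarrow> \<bar>f x - g x\<bar> \<le> e"
  shows "norm (B - C) \<le> e"
proof (rule field_le_epsilon)
  fix d :: real assume d: "d > 0"
  obtain p q where p: "uniform_limit (jspectrum A) (\<lambda>n. poly (p n)) f sequentially"
      "(\<lambda>n. jpoly (p n) A) \<longlonglongrightarrow> B"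
    and q: "uniform_limit (jspectrum A) (\<lambda>n. poly (q n)) g sequentially"
      "(\<lambda>n. jpoly (q n) A) \<longlonglongrightarrow> C"
    using f g unfolding has_jfun_calc_def by blast
  have "\<forall>\<^sub>F n in sequentially. norm (jpoly (p n) A - jpoly (q n) A) \<le> e + d"
    using uniform_limitD[OF p(1) half_gt_zero[OF d]] uniform_limitD[OF q(1) half_gt_zero[OF d]]
  proof eventually_elim
    case (elim n)
    have "norm (jpoly (p n - q n) A) \<le> e + d"
    proof (rule norm_jpoly_le)
      fix x assume x: "x \<in> jspectrum A"
      show "\<bar>poly (p n - q n) x\<bar> \<le> e + d"
        using elim[THEN bspec, OF x] e(2)[OF x] unfolding dist_real_def poly_diff by linarith
    qed (use e d in auto)
    then show ?case by (simp add: jpoly_diff)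
  qed
  then show "norm (B - C) \<le> e + d"
    by (intro tendsto_upperbound[OF tendsto_norm[OF tendsto_diff[OF p(2) q(2)]]]) auto
qed

lemma jfun_calc_eq:
  fixes A :: "'a::unital_jb_algebra"
  assumes "has_jfun_calc f A B"
  shows "jfun_calc f A = B"
  unfolding jfun_calc_def has_jfun_calc_def[symmetric]
proof (rule the_equality)
  fix C assume "has_jfun_calc f A C"
  then have "norm (C - B) \<le> 0"
    by (rule has_jfun_calc_norm_diff_le[OF _ assms]) auto
  then show "C = B" by simp
qed (fact assms)

lemma has_jfun_calc_poly: "has_jfun_calc (poly p) A (jpoly p A)"
  unfolding has_jfun_calc_def by (intro exI[of _ "\<lambda>_. p"]) (auto intro: uniform_limit_const)

lemma Weierstrass_poly_sequence:
  fixes f :: "real \<Rightarrow> real"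
  assumes "continuous_on {a..b} f"
  obtains p :: "nat \<Rightarrow> real poly" where "\<And>n x. x \<in> {a..b} \<Longrightarrow> \<bar>f x - poly (p n) x\<bar> < 1 / Suc n"
    "uniform_limit {a..b} (\<lambda>n. poly (p n)) f sequentially"
proof -
  have "\<exists>p. \<forall>x\<in>{a..b}. \<bar>f x - poly p x\<bar> < 1 / Suc n" for n
  proof -
    obtain g where g: "real_polynomial_function g" "\<And>x. x \<in> {a..b} \<Longrightarrow> \<bar>f x - g x\<bar> < 1 / Suc n"
      using Stone_Weierstrass_real_polynomial_function[OF compact_Icc assms, of "1 / Suc n"] by auto
    obtain c N where "g = (\<lambda>x. \<Sum>i\<le>N. c i * x ^ i)"
      using g(1) unfolding real_polynomial_function_iff_sum by blast
    then have "g = poly (\<Sum>i\<le>N. monom (c i) i)"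
      by (auto simp: poly_sum poly_monom)
    then show ?thesis using g(2) by blast
  qed
  then obtain p where p: "\<And>n x. x \<in> {a..b} \<Longrightarrow> \<bar>f x - poly (p n) x\<bar> < 1 / Suc n"
    by metis
  moreover have "uniform_limit {a..b} (\<lambda>n. poly (p n)) f sequentially"
  proof (rule uniform_limitI)
    fix e :: real assume "e > 0"
    then have "\<forall>\<^sub>F n in sequentially. 1 / real (Suc n) < e"
      by (intro order_tendstoD(2)[OF LIMSEQ_inverse_real_of_nat[unfolded inverse_eq_divide]])
    then show "\<forall>\<^sub>F n in sequentially. \<forall>x\<in>{a..b}. dist (poly (p n) x) (f x) < e"
      by eventually_elim (auto simp: dist_real_def abs_minus_commute intro: less_trans[OF p])
  qed
  ultimately show thesis by (rule that)
qed

lemma has_jfun_calc_continuous: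
  fixes A :: "'a::unital_jb_algebra"
  assumes f: "continuous_on {a..b} f" and A: "jspectrum A \<subseteq> {a..b}"
  shows "has_jfun_calc f A (jfun_calc f A)"
proof -
  obtain p where u: "uniform_limit {a..b} (\<lambda>n. poly (p n)) f sequentially"
    using Weierstrass_poly_sequence[OF f] by metis
  have u: "uniform_limit (jspectrum A) (\<lambda>n. poly (p n)) f sequentially"
    using uniform_limit_on_subset[OF u A] .
  have "Cauchy (\<lambda>n. jpoly (p n) A)"
  proof (rule metric_CauchyI)
    fix e :: real assume e: "e > 0"
    then have "\<forall>\<^sub>F n in sequentially. \<forall>x\<in>jspectrum A. dist (poly (p n) x) (f x) < e/4"
      using uniform_limitD[OF u, of "e/4"] by simp
    then obtain N where N: "\<And>n x. n \<ge> N \<Longrightarrow> x \<in> jspectrum A \<Longrightarrow> \<bar>poly (p n) x - f x\<bar> < e/4"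
      unfolding eventually_sequentially dist_real_def by blast
    have "dist (jpoly (p m) A) (jpoly (p n) A) < e" if "m \<ge> N" "n \<ge> N" for m n
    proof -
      have "norm (jpoly (p m - p n) A) \<le> e/2"
      proof (rule norm_jpoly_le)
        fix x assume "x \<in> jspectrum A"
        then show "\<bar>poly (p m - p n) x\<bar> \<le> e/2"
          unfolding poly_diff using N[of m x] N[of n x] that by linarith
      qed (use e in auto)
      then show ?thesis using e by (simp add: jpoly_diff dist_norm)
    qed
    then show "\<exists>M. \<forall>m\<ge>M. \<forall>n\<ge>M. dist (jpoly (p m) A) (jpoly (p n) A) < e" by blast
  qed
  then obtain B where "(\<lambda>n. jpoly (p n) A) \<longlonglongrightarrow> B"
    using Cauchy_convergent convergent_def by blast
  then have "has_jfun_calc f A B"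
    unfolding has_jfun_calc_def using u by blast
  then show ?thesis using jfun_calc_eq by metis
qed

lemma tendsto_jfun_calc:
  fixes A :: "'a::unital_jb_algebra"
  assumes f: "continuous_on {a..b} f" and A: "jspectrum A \<subseteq> {a..b}"
    and u: "uniform_limit {a..b} (\<lambda>n. poly (p n)) f sequentially"
  shows "(\<lambda>n. jpoly (p n) A) \<longlonglongrightarrow> jfun_calc f A"
proof (rule tendstoI)
  fix e :: real assume e: "e > 0"
  show "\<forall>\<^sub>F n in sequentially. dist (jpoly (p n) A) (jfun_calc f A) < e"
    using uniform_limitD[OF u half_gt_zero[OF e]]
  proof eventually_elim
    case (elim n)
    have "norm (jpoly (p n) A - jfun_calc f A) \<le> e / 2"
    proof (rule has_jfun_calc_norm_diff_le[OF has_jfun_calc_poly has_jfun_calc_continuous[OF f A]])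
      fix x assume "x \<in> jspectrum A"
      then show "\<bar>poly (p n) x - f x\<bar> \<le> e / 2"
        using elim A by (fastforce simp: dist_real_def)
    qed (use e in auto)
    then show ?case using e by (simp add: dist_norm)
  qed
qed

lemma tendsto_jpoly:
  fixes X :: "'b \<Rightarrow> 'a::unital_jb_algebra"
  assumes "(X \<longlongrightarrow> A) F"
  shows "((\<lambda>t. jpoly p (X t)) \<longlongrightarrow> jpoly p A) F"
  by (induction p) (auto simp: jpoly_pCons intro!: tendsto_intros jprod.tendsto assms)

lemma continuous_on_jpoly: "continuous_on S (\<lambda>X::'a::unital_jb_algebra. jpoly p X)"
  unfolding continuous_on by (auto intro: tendsto_jpoly tendsto_ident_at)

text \<open>
With the following lemma, this is the substitution rule with a polynomial as the outer, respectively
the inner, function.  Together they avoid the spectral mapping theorem.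
\<close>

lemma has_jfun_calc_poly_comp:
  fixes A :: "'a::unital_jb_algebra"
  assumes f: "has_jfun_calc f A B" and bd: "f ` jspectrum A \<subseteq> {a..b}"
  shows "has_jfun_calc (\<lambda>x. poly l (f x)) A (jpoly l B)"
proof -
  obtain p where u: "uniform_limit (jspectrum A) (\<lambda>n. poly (p n)) f sequentially"
    and lim: "(\<lambda>n. jpoly (p n) A) \<longlonglongrightarrow> B"
    using f unfolding has_jfun_calc_def by blast
  have "uniform_limit (jspectrum A) (\<lambda>n x. poly l (poly (p n) x)) (\<lambda>x. poly l (f x)) sequentially"
  proof (rule uniform_limit_compose_uniformly_continuous_on[OF u, of "{a - 1..b + 1}"])
    show "uniformly_continuous_on {a - 1..b + 1} (poly l)"
      by (intro compact_uniformly_continuous continuous_intros) auto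
    show "\<forall>\<^sub>F n in sequentially. \<forall>x\<in>jspectrum A. poly (p n) x \<in> {a - 1..b + 1}"
      using uniform_limitD[OF u, of 1, simplified]
    proof eventually_elim
      case (elim n)
      show ?case
      proof
        fix x assume x: "x \<in> jspectrum A"
        then have "f x \<in> {a..b}" "\<bar>poly (p n) x - f x\<bar> < 1"
          using bd elim by (auto simp: dist_real_def)
        then show "poly (p n) x \<in> {a - 1..b + 1}" by auto
      qed
    qed
  qed auto
  moreover have "(\<lambda>n. jpoly (pcompose l (p n)) A) \<longlonglongrightarrow> jpoly l B"
    unfolding jpoly_pcompose by (rule tendsto_jpoly[OF lim])
  moreover have "poly (pcompose l (p n)) = (\<lambda>x. poly l (poly (p n) x))" for n
    by (simp add: poly_pcompose fun_eq_iff)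
  ultimately show ?thesis
    unfolding has_jfun_calc_def by (intro exI[of _ "\<lambda>n. pcompose l (p n)"]) simp
qed

lemma has_jfun_calc_comp_poly:
  fixes A :: "'a::unital_jb_algebra"
  assumes f: "continuous_on {a..b} f" and "jspectrum (jpoly q A) \<subseteq> {a..b}"
    and q: "poly q ` jspectrum A \<subseteq> {a..b}"
  shows "has_jfun_calc (\<lambda>x. f (poly q x)) A (jfun_calc f (jpoly q A))"
proof -
  obtain p where u: "uniform_limit {a..b} (\<lambda>n. poly (p n)) f sequentially"
    using Weierstrass_poly_sequence[OF f] by metis
  have *: "(\<lambda>n. jpoly (p n) (jpoly q A)) \<longlonglongrightarrow> jfun_calc f (jpoly q A)"
    by (rule tendsto_jfun_calc[OF f _ u]) fact
  have "uniform_limit (jspectrum A) (\<lambda>n x. poly (p n) (poly q x)) (\<lambda>x. f (poly q x)) sequentially"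
    using q by (intro uniform_limit_compose'[OF u]) auto
  moreover have "poly (pcompose (p n) q) = (\<lambda>x. poly (p n) (poly q x))" for n
    by (simp add: poly_pcompose fun_eq_iff)
  ultimately show ?thesis using * unfolding has_jfun_calc_def
    by (intro exI[of _ "\<lambda>n. pcompose (p n) q"]) (simp add: jpoly_pcompose)
qed

lemma jspectrum_subset_cball:
  fixes A :: "'a::unital_jb_algebra"
  assumes "norm A \<le> K"
  shows "jspectrum A \<subseteq> {-K..K}"
  using jspectrum_subset_Icc[of A 0 K] assms by simp

text \<open>
On a ball all spectra lie in one compact interval, so the functional calculus is a uniform limit of
polynomials.  The elements of the ball need not commute with each other in any sense.
\<close>

lemma continuous_on_jfun_calc:
  assumes f: "continuous_on {-K..K} f"
  shows "continuous_on (cball 0 K) (jfun_calc f :: 'a::unital_jb_algebra \<Rightarrow> 'a)"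
proof -
  obtain p where u: "uniform_limit {-K..K} (\<lambda>n. poly (p n)) f sequentially"
    using Weierstrass_poly_sequence[OF f] by metis
  have "uniform_limit (cball 0 K) (\<lambda>n X. jpoly (p n) X) (jfun_calc f :: 'a \<Rightarrow> 'a) sequentially"
  proof (rule uniform_limitI)
    fix e :: real assume e: "e > 0"
    show "\<forall>\<^sub>F n in sequentially. \<forall>X\<in>cball 0 K. dist (jpoly (p n) X) (jfun_calc f (X::'a)) < e"
      using uniform_limitD[OF u half_gt_zero[OF e]]
    proof eventually_elim
      case (elim n)
      show ?case
      proof
        fix X :: 'a assume "X \<in> cball 0 K"
        then have X: "jspectrum X \<subseteq> {-K..K}"
          by (intro jspectrum_subset_cball) simp
        have "norm (jpoly (p n) X - jfun_calc f X) \<le> e / 2"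
        proof (rule has_jfun_calc_norm_diff_le[OF has_jfun_calc_poly has_jfun_calc_continuous[OF f X]])
          fix x assume "x \<in> jspectrum X"
          then show "\<bar>poly (p n) x - f x\<bar> \<le> e / 2"
            using elim X by (fastforce simp: dist_real_def)
        qed (use e in auto)
        then show "dist (jpoly (p n) X) (jfun_calc f X) < e" using e by (simp add: dist_norm)
      qed
    qed
  qed
  then show ?thesis
    by (rule uniform_limit_theorem[rotated]) (auto intro!: always_eventually continuous_on_jpoly)
qed

section \<open>The exponential\<close>

lemma has_jfun_calc_jexp:
  fixes X :: "'a::unital_jb_algebra"
  shows "has_jfun_calc exp X (jexp X)"
  unfolding jexp_def
  by (rule has_jfun_calc_continuous[OF _ jspectrum_subset_cball[OF order_refl]]) (intro continuous_intros)

lemma continuous_on_jexp: "continuous_on UNIV (jexp :: 'a::unital_jb_algebra \<Rightarrow> 'a)"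
proof -
  have "continuous_on (cball 0 K) (jexp :: 'a \<Rightarrow> 'a)" for K
    unfolding jexp_def by (intro continuous_on_jfun_calc continuous_intros)
  then have "continuous_on (ball 0 K) (jexp :: 'a \<Rightarrow> 'a)" for K
    using ball_subset_cball continuous_on_subset by blast
  then have "isCont (jexp :: 'a \<Rightarrow> 'a) x" for x
    using continuous_on_eq_continuous_at[OF open_ball, of 0 "norm x + 1" "jexp :: 'a \<Rightarrow> 'a"] by simp
  then show ?thesis by (simp add: continuous_on_eq_continuous_within)
qed

text \<open>
Polynomials \<open>l n\<close> that approximate the logarithm recover \<open>X\<close> from \<open>jexp X\<close>, because
\<open>l n \<circ> exp\<close> is uniformly close to the identity on the spectrum of \<open>X\<close>.
\<close>

lemma inj_jexp: "inj (jexp :: 'a::unital_jb_algebra \<Rightarrow> 'a)"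
proof (rule injI)
  fix X Y :: 'a assume eq: "jexp X = jexp Y"
  define K where "K = max (norm X) (norm Y)"
  have "continuous_on {exp (-K)..exp K} ln"
    by (intro continuous_intros) (auto dest: order.strict_trans2[OF exp_gt_zero])
  then obtain l where l: "\<And>n x. x \<in> {exp (-K)..exp K} \<Longrightarrow> \<bar>ln x - poly (l n) x\<bar> < 1 / Suc n"
    using Weierstrass_poly_sequence by metis
  have *: "norm (jpoly (l n) (jexp Z) - Z) \<le> 1 / Suc n" if "norm Z \<le> K" for n and Z :: 'a
  proof -
    have Z: "jspectrum Z \<subseteq> {-K..K}"
      by (rule jspectrum_subset_cball) fact
    have h: "has_jfun_calc (\<lambda>x. poly (l n) (exp x)) Z (jpoly (l n) (jexp Z))"
      using Z by (intro has_jfun_calc_poly_comp[OF has_jfun_calc_jexp, of _ "exp (-K)" "exp K"]) auto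
    have i: "has_jfun_calc (poly [:0, 1:]) Z Z"
      using has_jfun_calc_poly[of "[:0, 1:]" Z] by (simp only: jpoly_X)
    show ?thesis
    proof (rule has_jfun_calc_norm_diff_le[OF h i])
      fix x assume "x \<in> jspectrum Z"
      then show "\<bar>poly (l n) (exp x) - poly [:0, 1:] x\<bar> \<le> 1 / Suc n"
        using l[of "exp x" n] Z by (auto simp: abs_minus_commute less_imp_le)
    qed auto
  qed
  have "norm (X - Y) \<le> 2 / Suc n" for n
  proof -
    have "norm (X - Y) \<le> norm (jpoly (l n) (jexp Y) - Y) + norm (jpoly (l n) (jexp X) - X)"
      using norm_triangle_ineq4[of "jpoly (l n) (jexp Y) - Y" "jpoly (l n) (jexp X) - X"]
      by (simp add: eq algebra_simps)
    then show ?thesis using *[of X n] *[of Y n] by (simp add: K_def)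
  qed
  moreover have "(\<lambda>n. 2 / real (Suc n)) \<longlonglongrightarrow> 0"
    using tendsto_mult_right_zero[OF LIMSEQ_inverse_real_of_nat, of 2] by (simp add: divide_inverse)
  ultimately have "norm (X - Y) \<le> 0"
    by (intro LIMSEQ_le_const) auto
  then show "X = Y" by simp
qed

text \<open>
The logarithm of \<open>(1 + t x) powr (1 / t)\<close> differs from \<open>x\<close> by at most \<open>2 \<bar>t\<bar> K\<^sup>2\<close>.
\<close>

lemma powr_one_plus_bound:
  fixes t x K :: real
  assumes t: "t \<noteq> 0" and x: "\<bar>x\<bar> \<le> K" and tK: "\<bar>t\<bar> * K \<le> 1/2"
  shows "\<bar>(1 + t * x) powr (1 / t) - exp x\<bar> \<le> exp K * (exp (2 * \<bar>t\<bar> * K\<^sup>2) - 1)"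
proof -
  have "\<bar>t * x\<bar> \<le> \<bar>t\<bar> * K" using x by (simp add: abs_mult mult_left_mono)
  then have tx: "\<bar>t * x\<bar> \<le> 1/2" using tK by linarith
  define h where "h = ln (1 + t * x) / t - x"
  have "\<bar>ln (1 + t * x) - t * x\<bar> \<le> 2 * (t * x)\<^sup>2"
    by (rule abs_ln_one_plus_x_minus_x_bound[OF tx])
  moreover have "(t * x)\<^sup>2 \<le> (\<bar>t\<bar> * K)\<^sup>2"
    using \<open>\<bar>t * x\<bar> \<le> \<bar>t\<bar> * K\<close> by (metis abs_ge_zero power2_abs power_mono)
  moreover have "h * t = ln (1 + t * x) - t * x"
    using t by (simp add: h_def field_simps)
  ultimately have "\<bar>h\<bar> * \<bar>t\<bar> \<le> (2 * \<bar>t\<bar> * K\<^sup>2) * \<bar>t\<bar>"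
    by (simp add: abs_mult[symmetric] power_mult_distrib power2_eq_square mult_ac)
  then have h: "\<bar>h\<bar> \<le> 2 * \<bar>t\<bar> * K\<^sup>2" using t by (simp add: mult_ac)
  have "(1 + t * x) powr (1 / t) = exp (x + h)"
    using tx by (simp add: powr_def h_def)
  then have "\<bar>(1 + t * x) powr (1 / t) - exp x\<bar> = exp x * \<bar>exp h - 1\<bar>"
  proof -
    have "exp (x + h) - exp x = exp x * (exp h - 1)"
      by (simp add: exp_add algebra_simps)
    then show ?thesis using \<open>(1 + t * x) powr (1 / t) = exp (x + h)\<close> by (simp add: abs_mult)
  qed
  also have "\<bar>exp h - 1\<bar> \<le> exp \<bar>h\<bar> - 1"
  proof (cases "h \<ge> 0")
    case False
    have "1 + 1 \<le> exp h + exp (- h)"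
      using exp_ge_add_one_self[of h] exp_ge_add_one_self[of "-h"] by linarith
    then show ?thesis using False by simp
  qed simp
  also have "exp x * (exp \<bar>h\<bar> - 1) \<le> exp K * (exp (2 * \<bar>t\<bar> * K\<^sup>2) - 1)"
    using x h by (intro mult_mono) auto
  finally show ?thesis by simp
qed

text \<open>
Write \<open>\<gamma> t = 1 + t Z(t)\<close> with \<open>Z(t) \<rightarrow> Y\<close>.  For fixed \<open>t\<close> both
\<open>\<gamma> t powr\<^sub>J (1 / t)\<close> and \<open>jexp (Z t)\<close> are functions of \<open>Z t\<close>, so their distance is
bounded by the scalar distance of \<open>(1 + t x) powr (1 / t)\<close> and \<open>exp x\<close> on a bounded interval.
The elements \<open>Z t\<close> and \<open>Y\<close> are unrelated algebraically, and only continuity of \<open>jexp\<close> is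
used to pass to the limit.
\<close>

theorem tendsto_jpowr_inverse_at_unit:
  fixes \<gamma> :: "real \<Rightarrow> 'a::unital_jb_algebra"
  assumes der: "(\<gamma> has_vector_derivative Y) (at 0)" and one: "\<gamma> 0 = 1"
  shows "((\<lambda>t. \<gamma> t powr\<^sub>J (1 / t)) \<longlongrightarrow> jexp Y) (at 0)"
proof -
  define Z where "Z t = (1 / t) *\<^sub>R (\<gamma> t - 1)" for t
  have Z: "(Z \<longlongrightarrow> Y) (at 0)"
  proof -
    have "((\<lambda>h. norm (\<gamma> h - 1 - h *\<^sub>R Y) / norm h) \<longlongrightarrow> 0) (at 0)"
      using der one unfolding has_vector_derivative_def has_derivative_at by simp
    moreover have "\<forall>\<^sub>F h in at 0. norm (\<gamma> h - 1 - h *\<^sub>R Y) / norm h = norm (Z h - Y)"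
      unfolding eventually_at_filter
    proof (intro always_eventually allI impI)
      fix h :: real assume "h \<noteq> 0"
      then have "Z h - Y = (1 / h) *\<^sub>R (\<gamma> h - 1 - h *\<^sub>R Y)"
        by (simp add: Z_def scaleR_diff_right)
      then show "norm (\<gamma> h - 1 - h *\<^sub>R Y) / norm h = norm (Z h - Y)"
        by simp
    qed
    ultimately have "((\<lambda>h. norm (Z h - Y)) \<longlongrightarrow> 0) (at 0)"
      by (rule Lim_transform_eventually)
    then show ?thesis
      using LIM_zero_cancel tendsto_norm_zero_iff by blast
  qed
  define K where "K = norm Y + 1"
  have K: "K > 0" by (simp add: K_def add_nonneg_pos)
  have ZK: "\<forall>\<^sub>F t in at 0. norm (Z t) \<le> K"
    using order_tendstoD(2)[OF tendsto_norm[OF Z], of K] by (auto simp: K_def elim: eventually_mono)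
  have tK: "\<forall>\<^sub>F t in at 0. \<bar>t\<bar> * K \<le> 1/2"
  proof -
    have "((\<lambda>t::real. \<bar>t\<bar> * K) \<longlongrightarrow> \<bar>0\<bar> * K) (at 0)"
      by (intro tendsto_intros)
    then have "\<forall>\<^sub>F t in at 0. \<bar>t\<bar> * K < 1/2"
      by (rule order_tendstoD) simp
    then show ?thesis
      by eventually_elim simp
  qed
  have t0: "\<forall>\<^sub>F t in at (0::real). t \<noteq> 0"
    by (simp add: eventually_at_filter)
  have bound: "\<forall>\<^sub>F t in at 0. norm (\<gamma> t powr\<^sub>J (1 / t) - jexp (Z t)) \<le> exp K * (exp (2 * \<bar>t\<bar> * K\<^sup>2) - 1)"
    using ZK tK t0
  proof eventually_elim
    case (elim t)
    define q where "q = [:1, t:]"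
    have q: "jpoly q (Z t) = \<gamma> t"
      using elim by (simp add: q_def Z_def jpoly_pCons jprod_scaleR_right jprod_commute[of _ 1] jprod_one_left)
    have "norm (\<gamma> t - 1 *\<^sub>R 1) = \<bar>t\<bar> * norm (Z t)"
      using elim by (simp add: Z_def)
    also have "\<dots> \<le> \<bar>t\<bar> * K" using elim by (intro mult_left_mono) auto
    finally have spec: "jspectrum (\<gamma> t) \<subseteq> {1 - \<bar>t\<bar> * K..1 + \<bar>t\<bar> * K}"
      by (rule jspectrum_subset_Icc)
    have specZ: "jspectrum (Z t) \<subseteq> {-K..K}"
      by (rule jspectrum_subset_cball) (use elim in auto)
    have tx: "\<bar>t * x\<bar> \<le> \<bar>t\<bar> * K" if "x \<in> jspectrum (Z t)" for x
    proof -
      have "x \<in> {-K..K}" using specZ that by blast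
      then have "\<bar>x\<bar> \<le> K" by auto
      then show ?thesis unfolding abs_mult by (intro mult_left_mono) auto
    qed
    have "has_jfun_calc (\<lambda>x. poly q x powr (1 / t)) (Z t) (jfun_calc (\<lambda>x. x powr (1 / t)) (jpoly q (Z t)))"
    proof (rule has_jfun_calc_comp_poly)
      show "continuous_on {1 - \<bar>t\<bar> * K..1 + \<bar>t\<bar> * K} (\<lambda>x. x powr (1 / t))"
        using elim by (intro continuous_intros) auto
      show "poly q ` jspectrum (Z t) \<subseteq> {1 - \<bar>t\<bar> * K..1 + \<bar>t\<bar> * K}"
        using tx by (fastforce simp: q_def mult.commute abs_le_iff)
    qed (use spec q in simp)
    then have "has_jfun_calc (\<lambda>x. (1 + t * x) powr (1 / t)) (Z t) (\<gamma> t powr\<^sub>J (1 / t))"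
      by (simp add: q jpowr_def) (simp add: q_def mult.commute)
    then show ?case
    proof (rule has_jfun_calc_norm_diff_le[OF _ has_jfun_calc_jexp])
      fix x assume "x \<in> jspectrum (Z t)"
      then have "x \<in> {-K..K}" using specZ by blast
      then show "\<bar>(1 + t * x) powr (1 / t) - exp x\<bar> \<le> exp K * (exp (2 * \<bar>t\<bar> * K\<^sup>2) - 1)"
        using elim by (intro powr_one_plus_bound) auto
    qed simp
  qed
  have "((\<lambda>t. exp K * (exp (2 * \<bar>t\<bar> * K\<^sup>2) - 1)) \<longlongrightarrow> exp K * (exp (2 * \<bar>0\<bar> * K\<^sup>2) - 1)) (at 0)"
    by (intro tendsto_intros)
  then have diff: "((\<lambda>t. \<gamma> t powr\<^sub>J (1 / t) - jexp (Z t)) \<longlongrightarrow> 0) (at 0)"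
    by (intro Lim_null_comparison[OF bound]) simp
  have "isCont (jexp :: 'a \<Rightarrow> 'a) Y"
    using continuous_on_jexp[where 'a = 'a] by (simp add: continuous_on_eq_continuous_at)
  then have "((\<lambda>t. jexp (Z t)) \<longlongrightarrow> jexp Y) (at 0)"
    using Z by (rule isCont_tendsto_compose)
  from tendsto_add[OF diff this] show ?thesis by simp
qed

section \<open>Curves through the unit and Hansen's mean\<close>

lemma curve_at_unit_derivative:
  assumes "curve_at_unit \<epsilon> \<gamma>" "\<epsilon> > 0"
  shows "(\<gamma> has_vector_derivative vector_derivative \<gamma> (at 0)) (at 0)"
proof -
  have "\<gamma> differentiable (at 0)"
    using assms unfolding curve_at_unit_def differentiable_on_def
    by (metis at_within_open greaterThanLessThan_iff neg_less_0_iff_less open_greaterThanLessThan)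
  then show ?thesis by (simp add: vector_derivative_works)
qed

text \<open>
The Lie-Trotter formula determines the derivative of a mean of two curves: the \<open>1 / t\<close>-th powers of the mean
converge to the exponential of its derivative as well as to the exponential in the formula,
and the exponential is injective.
\<close>

lemma lie_trotter_2mean_curve:
  fixes G :: "'a::unital_jb_algebra \<Rightarrow> 'a \<Rightarrow> 'a"
  assumes G: "lie_trotter_2mean l G" and \<epsilon>: "\<epsilon> > 0"
    and \<gamma>: "curve_at_unit \<epsilon> \<gamma>1" "curve_at_unit \<epsilon> \<gamma>2"
  shows "curve_at_unit \<epsilon> (\<lambda>t. G (\<gamma>1 t) (\<gamma>2 t))"
    and "vector_derivative (\<lambda>t. G (\<gamma>1 t) (\<gamma>2 t)) (at 0) =
      (1 - l) *\<^sub>R vector_derivative \<gamma>1 (at 0) + l *\<^sub>R vector_derivative \<gamma>2 (at 0)"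
proof -
  let ?I = "{-\<epsilon><..<\<epsilon>}" and ?\<mu> = "\<lambda>t. G (\<gamma>1 t) (\<gamma>2 t)"
  have pos: "\<gamma>1 ` ?I \<subseteq> pos_cone" "\<gamma>2 ` ?I \<subseteq> pos_cone"
    using \<gamma> unfolding curve_at_unit_def by auto
  have "0 \<in> ?I" using \<epsilon> by simp
  then have "\<gamma>1 0 \<in> pos_cone" using pos by blast
  then have one: "(1::'a) \<in> pos_cone" using \<gamma> by (simp add: curve_at_unit_def)
  have w: "weighted_2mean G" and d: "(\<lambda>(A, B). G A B) differentiable_on (pos_cone \<times> pos_cone)"
    using G unfolding lie_trotter_2mean_def by auto
  have d12: "(\<lambda>t. (\<gamma>1 t, \<gamma>2 t)) differentiable_on ?I"
    unfolding differentiable_on_def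
  proof
    fix t assume "t \<in> ?I"
    then have "\<gamma>1 differentiable (at t within ?I)" "\<gamma>2 differentiable (at t within ?I)"
      using \<gamma> unfolding curve_at_unit_def differentiable_on_def by simp_all
    then obtain D1 D2 where "(\<gamma>1 has_derivative D1) (at t within ?I)" "(\<gamma>2 has_derivative D2) (at t within ?I)"
      unfolding differentiable_def by (elim exE)
    then have "((\<lambda>t. (\<gamma>1 t, \<gamma>2 t)) has_derivative (\<lambda>h. (D1 h, D2 h))) (at t within ?I)"
      by (rule has_derivative_Pair)
    then show "(\<lambda>t. (\<gamma>1 t, \<gamma>2 t)) differentiable (at t within ?I)"
      by (rule differentiableI)
  qed
  have dG: "(\<lambda>(A, B). G A B) differentiable_on (\<lambda>t. (\<gamma>1 t, \<gamma>2 t)) ` ?I"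
    by (rule differentiable_on_subset[OF d]) (use pos in auto)
  have "((\<lambda>(A, B). G A B) \<circ> (\<lambda>t. (\<gamma>1 t, \<gamma>2 t))) differentiable_on ?I"
    unfolding differentiable_on_def
  proof
    fix t assume "t \<in> ?I"
    then show "((\<lambda>(A, B). G A B) \<circ> (\<lambda>t. (\<gamma>1 t, \<gamma>2 t))) differentiable (at t within ?I)"
      using d12 dG unfolding differentiable_on_def by (intro differentiable_chain_within) simp_all
  qed
  then show c: "curve_at_unit \<epsilon> ?\<mu>"
    using w pos \<gamma> one unfolding curve_at_unit_def weighted_2mean_def
    by (auto simp: o_def image_subset_iff)
  have "((\<lambda>t. ?\<mu> t powr\<^sub>J (1 / t)) \<longlongrightarrow> jexp (vector_derivative ?\<mu> (at 0))) (at 0)"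
    by (rule tendsto_jpowr_inverse_at_unit[OF curve_at_unit_derivative[OF c \<epsilon>]])
       (use c in \<open>simp add: curve_at_unit_def\<close>)
  moreover have "((\<lambda>t. ?\<mu> t powr\<^sub>J (1 / t)) \<longlongrightarrow>
      jexp ((1 - l) *\<^sub>R vector_derivative \<gamma>1 (at 0) + l *\<^sub>R vector_derivative \<gamma>2 (at 0))) (at 0)"
    using G \<epsilon> \<gamma> unfolding lie_trotter_2mean_def by simp
  ultimately show "vector_derivative ?\<mu> (at 0) =
      (1 - l) *\<^sub>R vector_derivative \<gamma>1 (at 0) + l *\<^sub>R vector_derivative \<gamma>2 (at 0)"
    by (rule injD[OF inj_jexp, OF LIM_unique])
qed

lemma prob_vectors_butlast:
  assumes "\<omega> \<in> prob_vectors (Suc n)" "n \<ge> 1"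
  shows "0 < last \<omega>" "last \<omega> < 1"
    "map (\<lambda>x. x / (1 - last \<omega>)) (butlast \<omega>) \<in> prob_vectors n"
proof -
  have "\<omega> \<noteq> []" using assms by (auto simp: prob_vectors_def)
  then have \<omega>: "\<omega> = butlast \<omega> @ [last \<omega>]" by simp
  define v l where "v = butlast \<omega>" and "l = last \<omega>"
  have vl: "\<omega> = v @ [l]" using \<omega> unfolding v_def l_def .
  have v: "length v = n" "\<forall>x\<in>set v. x > 0" "sum_list v + l = 1" and l: "l > 0"
    using assms unfolding vl prob_vectors_def by auto
  have "v \<noteq> []" using v assms by auto
  then have "sum_list v > 0"
    using v(2) by (cases v) (auto intro!: add_pos_nonneg sum_list_nonneg simp: less_imp_le)
  then have 1: "l < 1" using v by simp
  have "sum_list (map (\<lambda>x. x / (1 - l)) v) = sum_list v / (1 - l)"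
    by (induction v) (simp_all add: add_divide_distrib)
  then have "map (\<lambda>x. x / (1 - l)) v \<in> prob_vectors n"
    using v l 1 by (auto simp: prob_vectors_def)
  then show "0 < last \<omega>" "last \<omega> < 1" "map (\<lambda>x. x / (1 - last \<omega>)) (butlast \<omega>) \<in> prob_vectors n"
    using l 1 by (simp_all add: v_def l_def)
qed

text \<open>
One step of Hansen's recursion replaces the curves \<open>\<gamma>\<^sub>k\<close>, \<open>k < n\<close>, by
\<open>\<mu>\<^sub>k = H2 (1 - l) l \<gamma>\<^sub>k \<delta>\<close> with \<open>\<delta>\<close> the last curve and \<open>l\<close> the last weight.  They have
derivatives \<open>(1 - l) \<gamma>\<^sub>k' + l \<delta>'\<close> at \<open>0\<close>.  The rescaled weights \<open>\<omega>\<^sub>k / (1 - l)\<close> cancel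
the factor \<open>1 - l\<close> and add up to \<open>1\<close>, which leaves \<open>\<Sum> \<omega>\<^sub>k \<gamma>\<^sub>k' + l \<delta>'\<close>.
\<close>

lemma hansen_mean_lie_trotter:
  fixes H2 :: "real \<Rightarrow> real \<Rightarrow> 'a::unital_jb_algebra \<Rightarrow> 'a \<Rightarrow> 'a"
  assumes H2: "\<And>l. 0 < l \<Longrightarrow> l < 1 \<Longrightarrow> lie_trotter_2mean l (H2 (1 - l) l)"
    and "2 \<le> n" "\<omega> \<in> prob_vectors n"
  shows "lie_trotter_mean n \<omega> (hansen_mean H2 n \<omega>)"
  using assms(2,3)
proof (induction n arbitrary: \<omega> rule: nat_induct_at_least)
  case base
  then obtain a b where \<omega>: "\<omega> = [a, b]"
    by (auto simp: prob_vectors_def length_Suc_conv numeral_2_eq_2)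
  then have ab: "a = 1 - b" "0 < b" "b < 1"
    using base by (auto simp: prob_vectors_def)
  have H: "lie_trotter_2mean b (H2 (1 - b) b)" using H2 ab by simp
  have h: "hansen_mean H2 2 \<omega> As = H2 (1 - b) b (As ! 0) (As ! 1)" for As
    by (simp add: hansen_mean.simps \<omega> ab)
  show ?case
    unfolding lie_trotter_mean_def weighted_mean_def h
  proof (intro conjI allI impI ballI)
    fix As :: "'a list" assume "length As = 2 \<and> set As \<subseteq> pos_cone"
    then show "H2 (1 - b) b (As ! 0) (As ! 1) \<in> pos_cone"
      using H unfolding lie_trotter_2mean_def weighted_2mean_def by (auto simp: subset_iff)
  next
    fix A :: 'a assume "A \<in> pos_cone"
    then show "H2 (1 - b) b (replicate 2 A ! 0) (replicate 2 A ! 1) = A"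
      using H unfolding lie_trotter_2mean_def weighted_2mean_def by simp
  next
    fix \<epsilon> :: real and \<gamma>s :: "(real \<Rightarrow> 'a) list"
    assume \<epsilon>: "\<epsilon> > 0" and \<gamma>: "length \<gamma>s = 2 \<and> (\<forall>\<gamma>\<in>set \<gamma>s. curve_at_unit \<epsilon> \<gamma>)"
    then have "curve_at_unit \<epsilon> (\<gamma>s ! 0)" "curve_at_unit \<epsilon> (\<gamma>s ! 1)" by auto
    then have "((\<lambda>t. H2 (1 - b) b ((\<gamma>s ! 0) t) ((\<gamma>s ! 1) t) powr\<^sub>J (1 / t)) \<longlongrightarrow>
       jexp ((1 - b) *\<^sub>R vector_derivative (\<gamma>s ! 0) (at 0) + b *\<^sub>R vector_derivative (\<gamma>s ! 1) (at 0))) (at 0)"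
      using H \<epsilon> unfolding lie_trotter_2mean_def by simp
    then show "((\<lambda>t. H2 (1 - b) b (map (\<lambda>\<gamma>. \<gamma> t) \<gamma>s ! 0) (map (\<lambda>\<gamma>. \<gamma> t) \<gamma>s ! 1) powr\<^sub>J (1 / t)) \<longlongrightarrow>
       jexp (\<Sum>k<2. (\<omega> ! k) *\<^sub>R vector_derivative (\<gamma>s ! k) (at 0))) (at 0)"
      using \<gamma> by (simp add: \<omega> ab numeral_2_eq_2)
  qed
next
  case (Suc n)
  define l where "l = last \<omega>"
  define \<omega>' where "\<omega>' = map (\<lambda>x. x / (1 - l)) (butlast \<omega>)"
  have n: "n \<ge> 1" using Suc.hyps by simp
  have l: "0 < l" "l < 1" and \<omega>': "\<omega>' \<in> prob_vectors n"
    using prob_vectors_butlast[OF Suc.prems n] by (simp_all add: l_def \<omega>'_def)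
  have len: "length \<omega> = Suc n" using Suc.prems by (simp add: prob_vectors_def)
  have IH: "lie_trotter_mean n \<omega>' (hansen_mean H2 n \<omega>')"
    by (rule Suc.IH[OF \<omega>'])
  have H: "lie_trotter_2mean l (H2 (1 - l) l)" using H2 l by simp
  then have w: "weighted_2mean (H2 (1 - l) l)" by (simp add: lie_trotter_2mean_def)
  have h: "hansen_mean H2 (Suc n) \<omega> As =
     hansen_mean H2 n \<omega>' (map (\<lambda>A. H2 (1 - l) l A (last As)) (butlast As))" for As
    using Suc.hyps by (subst hansen_mean.simps) (simp add: \<omega>'_def l_def)
  show ?case
    unfolding lie_trotter_mean_def weighted_mean_def h
  proof (intro conjI allI impI ballI)
    fix As :: "'a list" assume As: "length As = Suc n \<and> set As \<subseteq> pos_cone"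
    then have "As \<noteq> []" by auto
    then have "last As \<in> pos_cone" "set (butlast As) \<subseteq> pos_cone"
      using As by (auto dest: in_set_butlastD)
    then have "set (map (\<lambda>A. H2 (1 - l) l A (last As)) (butlast As)) \<subseteq> pos_cone"
      using w unfolding weighted_2mean_def by auto
    then show "hansen_mean H2 n \<omega>' (map (\<lambda>A. H2 (1 - l) l A (last As)) (butlast As)) \<in> pos_cone"
      using IH As unfolding lie_trotter_mean_def weighted_mean_def by simp
  next
    fix A :: 'a assume A: "A \<in> pos_cone"
    have "replicate (Suc n) A = replicate n A @ [A]"
      by (simp add: replicate_append_same)
    then have "map (\<lambda>B. H2 (1 - l) l B (last (replicate (Suc n) A))) (butlast (replicate (Suc n) A)) = replicate n A"
      using A w unfolding weighted_2mean_def by (simp del: replicate_Suc)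
    then show "hansen_mean H2 n \<omega>' (map (\<lambda>B. H2 (1 - l) l B (last (replicate (Suc n) A))) (butlast (replicate (Suc n) A))) = A"
      using IH A unfolding lie_trotter_mean_def weighted_mean_def by simp
  next
    fix \<epsilon> :: real and \<gamma>s :: "(real \<Rightarrow> 'a) list"
    assume \<epsilon>: "\<epsilon> > 0" and \<gamma>: "length \<gamma>s = Suc n \<and> (\<forall>\<gamma>\<in>set \<gamma>s. curve_at_unit \<epsilon> \<gamma>)"
    then have ne: "\<gamma>s \<noteq> []" by auto
    define \<delta> where "\<delta> = last \<gamma>s"
    define D where "D \<gamma> = vector_derivative \<gamma> (at 0)" for \<gamma> :: "real \<Rightarrow> 'a"
    define \<mu> where "\<mu> \<gamma> t = H2 (1 - l) l (\<gamma> t) (\<delta> t)" for \<gamma> t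
    define \<mu>s where "\<mu>s = map \<mu> (butlast \<gamma>s)"
    have \<delta>: "curve_at_unit \<epsilon> \<delta>" using \<gamma> ne by (simp add: \<delta>_def)
    have \<mu>: "curve_at_unit \<epsilon> (\<mu> \<gamma>)" "D (\<mu> \<gamma>) = (1 - l) *\<^sub>R D \<gamma> + l *\<^sub>R D \<delta>"
      if "\<gamma> \<in> set \<gamma>s" for \<gamma>
      using lie_trotter_2mean_curve[OF H \<epsilon> _ \<delta>, of \<gamma>] that \<gamma> by (auto simp: \<mu>_def[abs_def] D_def)
    have \<mu>s: "length \<mu>s = n" "\<forall>\<gamma>\<in>set \<mu>s. curve_at_unit \<epsilon> \<gamma>"
      using \<gamma> \<mu>(1) by (auto simp: \<mu>s_def dest: in_set_butlastD)
    have lim: "((\<lambda>t. hansen_mean H2 n \<omega>' (map (\<lambda>\<gamma>. \<gamma> t) \<mu>s) powr\<^sub>J (1 / t)) \<longlongrightarrow>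
        jexp (\<Sum>k<n. (\<omega>' ! k) *\<^sub>R D (\<mu>s ! k))) (at 0)"
      using IH \<mu>s \<epsilon> unfolding lie_trotter_mean_def D_def by simp
    have nth: "\<omega>' ! k = \<omega> ! k / (1 - l)" "D (\<mu>s ! k) = (1 - l) *\<^sub>R D (\<gamma>s ! k) + l *\<^sub>R D \<delta>"
      if "k < n" for k
      using that \<gamma> len \<mu>(2)[of "\<gamma>s ! k"] by (auto simp: \<omega>'_def \<mu>s_def nth_butlast)
    have last: "\<omega> ! n = l" "\<gamma>s ! n = \<delta>"
    proof -
      have "\<omega> \<noteq> []" using len by auto
      then show "\<omega> ! n = l" "\<gamma>s ! n = \<delta>"
        using \<gamma> len ne by (simp_all add: l_def \<delta>_def last_conv_nth)
    qed
    have one: "(\<Sum>k<n. \<omega>' ! k) = 1"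
      using \<omega>' sum_list_sum_nth[of \<omega>'] by (auto simp: prob_vectors_def atLeast0LessThan)
    have "(\<Sum>k<n. (\<omega>' ! k) *\<^sub>R D (\<mu>s ! k)) =
        (\<Sum>k<n. (\<omega> ! k) *\<^sub>R D (\<gamma>s ! k) + (\<omega>' ! k) *\<^sub>R (l *\<^sub>R D \<delta>))"
    proof (rule sum.cong[OF refl])
      fix k assume "k \<in> {..<n}"
      then show "(\<omega>' ! k) *\<^sub>R D (\<mu>s ! k) = (\<omega> ! k) *\<^sub>R D (\<gamma>s ! k) + (\<omega>' ! k) *\<^sub>R (l *\<^sub>R D \<delta>)"
        using l by (simp add: nth scaleR_add_right)
    qed
    also have "\<dots> = (\<Sum>k<n. (\<omega> ! k) *\<^sub>R D (\<gamma>s ! k)) + l *\<^sub>R D \<delta>"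
      unfolding sum.distrib scaleR_sum_left[symmetric] one by simp
    also have "\<dots> = (\<Sum>k<Suc n. (\<omega> ! k) *\<^sub>R D (\<gamma>s ! k))"
      by (simp add: last)
    finally have sum: "(\<Sum>k<n. (\<omega>' ! k) *\<^sub>R D (\<mu>s ! k)) = (\<Sum>k<Suc n. (\<omega> ! k) *\<^sub>R D (\<gamma>s ! k))" .
    have "map (\<lambda>A. H2 (1 - l) l A (last (map (\<lambda>\<gamma>. \<gamma> t) \<gamma>s))) (butlast (map (\<lambda>\<gamma>. \<gamma> t) \<gamma>s)) = map (\<lambda>\<gamma>. \<gamma> t) \<mu>s" for t
      using ne by (simp add: \<mu>s_def \<mu>_def \<delta>_def last_map map_butlast[symmetric])
    then show "((\<lambda>t. hansen_mean H2 n \<omega>' (map (\<lambda>A. H2 (1 - l) l A (last (map (\<lambda>\<gamma>. \<gamma> t) \<gamma>s)))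
          (butlast (map (\<lambda>\<gamma>. \<gamma> t) \<gamma>s))) powr\<^sub>J (1 / t)) \<longlongrightarrow>
        jexp (\<Sum>k<Suc n. (\<omega> ! k) *\<^sub>R vector_derivative (\<gamma>s ! k) (at 0))) (at 0)"
      using lim sum by (simp only: D_def)
  qed
qed

theorem theorem4p11:
  fixes H2 :: "real \<Rightarrow> real \<Rightarrow> 'a::unital_jb_algebra \<Rightarrow> 'a \<Rightarrow> 'a"
  assumes "\<And>l. 0 < l \<Longrightarrow> l < 1 \<Longrightarrow> lie_trotter_2mean l (H2 (1 - l) l)"
  shows "\<forall>n\<ge>2. \<forall>\<omega>\<in>prob_vectors n. lie_trotter_mean n \<omega> (hansen_mean H2 n \<omega>)"
  by (intro allI impI ballI hansen_mean_lie_trotter[of H2]) (erule (1) assms | assumption)+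

end
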